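(* Let $(X,T,\mathcal{A},\mu)$ be a conservative ergodic measure preserving dynamical system, where $\mu$ is an infinite $\sigma$-finite measure. Let $A\in\mathcal{A}$ with $0<\mu(A)<\infty$ be a uniform set. Suppose that the wandering rate $(W_n)=(W_n(A))$ is regularly varying with exponent $1$ such that $W_n\sim n\cdot\frac{1}{L(n)}$ as $n\to\infty$, where $L$ is a slowly varying function. Then $$\frac{L(Z_n)}{L(n)}\ \stackrel{\mathcal{L}(\mu)}{\Longrightarrow}\ \boldsymbol{U},$$ where $\boldsymbol{U}$ denotes a random variable uniformly distributed on $[0,1]$.
   Context: $\mathcal{P}_\mu$ denotes the set of probability measures $\nu$ on $\mathcal{A}$ with $\nu\ll\mu$; the same symbol is used for the set of the corresponding densities $d\nu/d\mu$. The transfer operator $\hat T:L_1(\mu)\to L_1(\mu)$ is the positive linear operator characterized by $\int_B\hat T(f)\,d\mu=\int_{T^{-1}(B)}f\,d\mu$ for all $f\in L_1(\mu)$, $B\in\mathcal{A}$. A set $A\in\mathcal{A}$ with $0<\mu(A)<\infty$ is uniform for $f\in\mathcal{P}_\mu$ if there is a sequence $(a_n)$ of positive reals such that $\frac1{a_n}\sum_{k=0}^{n-1}\hat T^k(f)\to1$ $\mu$-a.e. uniformly on $A$ (i.e. in $L_\infty$-norm on $A$). It is called uniform if it is uniform for some $f\in\mathcal{P}_\mu$. Put $A_n:=\bigcup_{k=0}^nT^{-k}A$. The wandering rate of $A$ is the sequence $W_n=W_n(A):=\mu(A_n)$, $n\ge0$. $Z_n(x):=\max\{k\le n: T^k(x)\in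 A\}$ (with $k\geq 0$) if $x\in A_n$, and $Z_n(x):=0$ otherwise. A measurable function $R:\mathbb{R}^+\to\mathbb{R}$ ($\mathbb{R}^+=[0,\infty)$) with $R>0$ on $(a,\infty)$ for some $a>0$ is regularly varying (at $\infty$) with exponent $\rho\in\mathbb{R}$ if $\lim_{t\to\infty}R(\lambda t)/R(t)=\lambda^\rho$ for all $\lambda>0$; it is slowly varying if $\rho=0$. A sequence $(u_n)$ is regularly varying with exponent $\rho$ if $u_n=R(n)$, $n\ge1$, for some function $R$ regularly varying with exponent $\rho$. $c_n\sim a_n$ means $a_n\neq0$ for all but finitely many $n$ and $c_n/a_n\to1$. Strong distributional convergence $R_n\stackrel{\mathcal{L}(\mu)}{\Longrightarrow}R$ of measurable functions $R_n:X\to\mathbb{R}$ to a random variable $R$ means that for every $\nu\in\mathcal{P}_\mu$ the $R_n$, viewed as random variables on $(X,\mathcal{A},\nu)$, converge in distribution to $R$. *)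

theory Defs
  imports "HOL-Probability.Probability" "HOL-Library.Landau_Symbols"
begin

section \<open>Conservative ergodic measure preserving systems\<close>

text \<open>
  Sets are pulled back relative to \<^term>\<open>space M\<close>, which is the phase space $X$ and may be a
  proper subset of the type. A set is wandering if its preimages of all orders $n \geq 0$ are
  pairwise disjoint.
\<close>

locale conservative_ergodic_system = sigma_finite_measure M
  for M :: "'a measure" +
  fixes T :: "'a \<Rightarrow> 'a"
  assumes measurable_T: "T \<in> measurable M M"
    and preserving: "B \<in> sets M \<Longrightarrow> emeasure M (T -` B \<inter> space M) = emeasure M B"
    and conservative: "W \<in> sets M \<Longrightarrow> disjoint_family (\<lambda>n. (T ^^ n) -` W \<inter> space M)
                         \<Longrightarrow> emeasure M W = 0"
    and ergodic: "B \<in> sets M \<Longrightarrow> T -` B \<inter> space M = B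
                         \<Longrightarrow> emeasure M B = 0 \<or> emeasure M (space M - B) = 0"

section \<open>The transfer operator\<close>

definition is_transfer :: "'a measure \<Rightarrow> ('a \<Rightarrow> 'a) \<Rightarrow> ('a \<Rightarrow> real) \<Rightarrow> ('a \<Rightarrow> real) \<Rightarrow> bool" where
  "is_transfer M T f g \<longleftrightarrow> integrable M g \<and>
     (\<forall>B\<in>sets M. set_lebesgue_integral M B g = set_lebesgue_integral M (T -` B \<inter> space M) f)"

text \<open>
  Elements of $L_1$ are represented by integrable functions, and the transfer operator picks some
  representative of the image class. The two lemmas below show that for integrable arguments
  such a representative exists and is unique almost everywhere.
\<close>

definition transfer_op :: "'a measure \<Rightarrow> ('a \<Rightarrow> 'a) \<Rightarrow> ('a \<Rightarrow> real) \<Rightarrow> 'a \<Rightarrow> real" where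
  "transfer_op M T f = (SOME g. is_transfer M T f g)"

lemma (in conservative_ergodic_system) is_transfer_nonneg_exists:
  assumes f: "integrable M f" and nn: "\<And>x. 0 \<le> f x"
  shows "\<exists>g. is_transfer M T f g"
proof -
  note [measurable] = measurable_T borel_measurable_integrable[OF f]
  define N where "N = distr (density M (\<lambda>x. ennreal (f x))) M T"
  have fin: "(\<integral>\<^sup>+x. ennreal (f x) * indicator S x \<partial>M) < \<infinity>" if "S \<in> sets M" for S
  proof -
    have "(\<integral>\<^sup>+x. ennreal (f x) * indicator S x \<partial>M) \<le> (\<integral>\<^sup>+x. ennreal (f x) \<partial>M)"
      by (intro nn_integral_mono) (auto simp: indicator_def)
    also have "\<dots> < \<infinity>"
      using f nn by (simp add: nn_integral_eq_integral)
    finally show ?thesis .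
  qed
  have N_eq: "emeasure N B = (\<integral>\<^sup>+x. ennreal (f x) * indicator (T -` B \<inter> space M) x \<partial>M)"
    if [measurable]: "B \<in> sets M" for B
    by (simp add: N_def emeasure_distr emeasure_density)
  have sets_N: "sets N = sets M" and space_N: "space N = space M"
    by (simp_all add: N_def)
  have fin_N: "finite_measure N"
    using N_eq[of "space M"] fin[of "T -` space M \<inter> space M"]
    by (intro finite_measureI) (simp add: space_N)
  have ac: "absolutely_continuous M N"
  proof (unfold absolutely_continuous_def, rule subsetI)
    fix B assume B: "B \<in> null_sets M"
    then have [measurable]: "B \<in> sets M" by auto
    have "T -` B \<inter> space M \<in> null_sets M"
      using preserving[of B] B by (auto simp: null_sets_def)
    then have "emeasure N B = 0"
      by (simp add: N_eq nn_integral_null_set)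
    then show "B \<in> null_sets N"
      by (auto simp: null_sets_def sets_N)
  qed
  obtain D where D[measurable]: "D \<in> borel_measurable M"
    and RN: "AE x in M. RN_deriv M N x = ennreal (D x)" and Dnn: "\<And>x. 0 \<le> D x"
    using real_RN_deriv[OF fin_N ac sets_N] by blast
  have N_D: "emeasure N B = (\<integral>\<^sup>+x. ennreal (D x) * indicator B x \<partial>M)"
    if [measurable]: "B \<in> sets M" for B
  proof -
    have "emeasure N B = emeasure (density M (RN_deriv M N)) B"
      by (simp add: density_RN_deriv[OF ac sets_N])
    also have "\<dots> = (\<integral>\<^sup>+x. RN_deriv M N x * indicator B x \<partial>M)"
      by (simp add: emeasure_density)
    also have "\<dots> = (\<integral>\<^sup>+x. ennreal (D x) * indicator B x \<partial>M)"
      by (intro nn_integral_cong_AE) (use RN in auto)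
    finally show ?thesis .
  qed
  have "emeasure N (space M) < \<infinity>"
    using finite_measure.emeasure_finite[OF fin_N, of "space M"] by (simp add: top.not_eq_extremum)
  then have "(\<integral>\<^sup>+x. ennreal (D x) \<partial>M) < \<infinity>"
    by (simp add: N_D nn_integral_set_ennreal cong: nn_integral_cong_simp)
  then have D_int: "integrable M D"
    using Dnn by (intro integrableI_nonneg) auto
  have "set_lebesgue_integral M B D = set_lebesgue_integral M (T -` B \<inter> space M) f"
    if [measurable]: "B \<in> sets M" for B
  proof -
    have "set_lebesgue_integral M B D = enn2real (\<integral>\<^sup>+x. ennreal (D x) * indicator B x \<partial>M)"
      unfolding set_lebesgue_integral_def using Dnn
      by (subst integral_eq_nn_integral)
         (auto intro!: arg_cong[where f = enn2real] nn_integral_cong simp: indicator_def)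
    also have "\<dots> = enn2real (\<integral>\<^sup>+x. ennreal (f x) * indicator (T -` B \<inter> space M) x \<partial>M)"
      using N_D N_eq that by simp
    also have "\<dots> = set_lebesgue_integral M (T -` B \<inter> space M) f"
      unfolding set_lebesgue_integral_def using nn
      by (subst integral_eq_nn_integral)
         (auto intro!: arg_cong[where f = enn2real] nn_integral_cong simp: indicator_def)
    finally show ?thesis .
  qed
  then show ?thesis
    using D_int unfolding is_transfer_def by blast
qed

lemma (in conservative_ergodic_system) is_transfer_transfer_op:
  assumes f: "integrable M f"
  shows "is_transfer M T f (transfer_op M T f)"
proof -
  note [measurable] = measurable_T
  have i1: "integrable M (\<lambda>x. max 0 (f x))" and i2: "integrable M (\<lambda>x. max 0 (- f x))"
    using f by auto
  obtain g where g: "is_transfer M T (\<lambda>x. max 0 (f x)) g"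
    using is_transfer_nonneg_exists[OF i1] by auto
  obtain h where h: "is_transfer M T (\<lambda>x. max 0 (- f x)) h"
    using is_transfer_nonneg_exists[OF i2] by auto
  have si: "set_integrable M B u" if "integrable M u" "B \<in> sets M" for B and u :: "'a \<Rightarrow> real"
    using that unfolding set_integrable_def by (intro integrable_mult_indicator)
  have "is_transfer M T f (\<lambda>x. g x - h x)"
    unfolding is_transfer_def
  proof (intro conjI ballI)
    show "integrable M (\<lambda>x. g x - h x)"
      using g h by (auto simp: is_transfer_def)
  next
    fix B assume B[measurable]: "B \<in> sets M"
    have "(LINT x:B|M. g x - h x) = (LINT x:B|M. g x) - (LINT x:B|M. h x)"
      using g h B by (intro set_integral_diff si) (auto simp: is_transfer_def)
    also have "\<dots> = (LINT x:T -` B \<inter> space M|M. max 0 (f x)) -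
                      (LINT x:T -` B \<inter> space M|M. max 0 (- f x))"
      using g h B by (simp add: is_transfer_def)
    also have "\<dots> = (LINT x:T -` B \<inter> space M|M. max 0 (f x) - max 0 (- f x))"
      by (intro set_integral_diff(2)[symmetric] si i1 i2) measurable
    also have "\<dots> = (LINT x:T -` B \<inter> space M|M. f x)"
      by (rule arg_cong[where f = "set_lebesgue_integral M _"]) (auto simp: max_def)
    finally show "(LINT x:B|M. g x - h x) = (LINT x:T -` B \<inter> space M|M. f x)" .
  qed
  then show ?thesis
    unfolding transfer_op_def by (rule someI[where P = "is_transfer M T f"])
qed

lemma (in conservative_ergodic_system) is_transfer_unique:
  assumes g: "is_transfer M T f g" and h: "is_transfer M T f h"
  shows "AE x in M. g x = h x"
  using g h by (intro density_unique_real) (auto simp: is_transfer_def)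

section \<open>Uniform sets\<close>

definition ac_prob :: "'a measure \<Rightarrow> 'a measure set" where
  "ac_prob M = {\<nu>. prob_space \<nu> \<and> sets \<nu> = sets M \<and> absolutely_continuous M \<nu>}"

text \<open>
  The nonnegativity clause is needed because \<^const>\<open>ennreal\<close> truncates negative values to 0.
\<close>

definition ac_prob_density :: "'a measure \<Rightarrow> ('a \<Rightarrow> real) set" where
  "ac_prob_density M = {f. f \<in> borel_measurable M \<and> (AE x in M. 0 \<le> f x) \<and>
     density M (\<lambda>x. ennreal (f x)) \<in> ac_prob M}"

definition uniform_set_for :: "'a measure \<Rightarrow> ('a \<Rightarrow> 'a) \<Rightarrow> 'a set \<Rightarrow> ('a \<Rightarrow> real) \<Rightarrow> bool" where
  "uniform_set_for M T A f \<longleftrightarrow> A \<in> sets M \<and> 0 < emeasure M A \<and> emeasure M A < \<infinity> \<and>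
     f \<in> ac_prob_density M \<and>
     (\<exists>a :: nat \<Rightarrow> real. (\<forall>n. 0 < a n) \<and>
       (\<exists>N\<in>null_sets M. uniform_limit (A - N)
          (\<lambda>n x. 1 / a n * (\<Sum>k<n. (transfer_op M T ^^ k) f x)) (\<lambda>_. 1) sequentially))"

definition uniform_set :: "'a measure \<Rightarrow> ('a \<Rightarrow> 'a) \<Rightarrow> 'a set \<Rightarrow> bool" where
  "uniform_set M T A \<longleftrightarrow> (\<exists>f. uniform_set_for M T A f)"

section \<open>Wandering rate and last visit\<close>

definition hit_set :: "'a measure \<Rightarrow> ('a \<Rightarrow> 'a) \<Rightarrow> 'a set \<Rightarrow> nat \<Rightarrow> 'a set" where
  "hit_set M T A n = (\<Union>k\<le>n. (T ^^ k) -` A \<inter> space M)"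

text \<open>
  For a measure preserving \<open>T\<close> the measure of \<^term>\<open>hit_set M T A n\<close> is at most $(n+1)\mu(A)$, so
  the real-valued \<^const>\<open>measure\<close> loses nothing when $\mu(A)$ is finite.
\<close>

definition wandering_rate :: "'a measure \<Rightarrow> ('a \<Rightarrow> 'a) \<Rightarrow> 'a set \<Rightarrow> nat \<Rightarrow> real" where
  "wandering_rate M T A n = measure M (hit_set M T A n)"

definition last_visit :: "'a measure \<Rightarrow> ('a \<Rightarrow> 'a) \<Rightarrow> 'a set \<Rightarrow> nat \<Rightarrow> 'a \<Rightarrow> nat" where
  "last_visit M T A n x =
     (if x \<in> hit_set M T A n then Max {k. k \<le> n \<and> (T ^^ k) x \<in> A} else 0)"

section \<open>Regular variation\<close>

text \<open>
  Functions on $[0,\infty)$ are represented by functions on the reals whose values at negative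
  arguments are irrelevant. Measurability is with respect to Lebesgue measurable sets, which
  includes all Borel functions.
\<close>

definition regularly_varying :: "real \<Rightarrow> (real \<Rightarrow> real) \<Rightarrow> bool" where
  "regularly_varying \<rho> R \<longleftrightarrow> R \<in> borel_measurable (lebesgue_on {0..}) \<and>
     (\<exists>a>0. \<forall>t>a. 0 < R t) \<and>
     (\<forall>c>0. ((\<lambda>t. R (c * t) / R t) \<longlongrightarrow> c powr \<rho>) at_top)"

abbreviation slowly_varying :: "(real \<Rightarrow> real) \<Rightarrow> bool" where
  "slowly_varying \<equiv> regularly_varying 0"

definition regularly_varying_seq :: "real \<Rightarrow> (nat \<Rightarrow> real) \<Rightarrow> bool" where
  "regularly_varying_seq \<rho> u \<longleftrightarrow>
     (\<exists>R. regularly_varying \<rho> R \<and> (\<forall>n\<ge>1. u n = R (real n)))"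

section \<open>Strong distributional convergence\<close>

text \<open>
  The limit is a random variable \<open>Y\<close> on an arbitrary probability space \<open>P\<close>, unrelated to \<open>M\<close>.
\<close>

definition strong_distr_conv ::
  "'a measure \<Rightarrow> (nat \<Rightarrow> 'a \<Rightarrow> real) \<Rightarrow> 'b measure \<Rightarrow> ('b \<Rightarrow> real) \<Rightarrow> bool" where
  "strong_distr_conv M R P Y \<longleftrightarrow> (\<forall>n. R n \<in> borel_measurable M) \<and>
     (\<forall>\<nu>\<in>ac_prob M. weak_conv_m (\<lambda>n. distr \<nu> borel (R n)) (distr P borel Y))"

end

theory Submission
  imports Defs
begin

text \<open>
  Let $w_j$ be the measure of the set of points of $A$ that do not visit $A$ during the times
  $1, \dots, j$. Decomposing $A_n$ according to the last visit gives $W_n = w_0 + \dots + w_n$, so regular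
  variation of $W$ and monotonicity of $w$ yield $w_n \sim W_n / n \sim 1 / L(n)$.
  If $A$ is uniform for $f$ with normalizing sequence $a$, the same decomposition bounds the probability
  of $Z_n \leq m$ under $f$ between approximately $a_m w_n$ and $a_m w_{n-m}$, and forces $a_n w_n \to 1$. Hence this
  probability is asymptotic to $w_n / w_m$ for large $m \leq n/2$. Since $L(m) \sim 1 / w_m$ with $w$ monotone, the event
  $L(Z_n) \leq u L(n)$ is essentially $Z_n \leq m_n$ with $w_n / w_{m_n} \to u$.
  For other initial densities, the indicators of $Z_n \leq m_n$ are asymptotically invariant, as they
  change under $T$ only on visits to $A$ at the times $n + 1$ and $m_n + 1$, and such visits become
  improbable.
\<close>

text \<open>Uniformity controls visits to one fixed set, whereas the decomposition by the last visit
  pairs each time k with its own set \<open>excursion_set M T A (n - k)\<close>. These sets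
  decrease, so n - k may be replaced by n from below and, for m \<le> n/2, by n/2 from above; slow
  variation of w closes the gap. The sets also shrink as n grows. The estimate survives because
  uniform convergence on A has an error proportional to the measure of B, simultaneously for all
  measurable B inside A. Regular variation enters through the doubling limit W(2n)/W(n) -> 2. L is
  comparable with the monotone 1/w only asymptotically. Hence the event L(Z_n) \<le> u L(n) is
  trapped between events Z_n \<le> m belonging to levels t slightly below and above u, up to the
  points whose last visit is at most a fixed K. Changing the density takes two rounds, since
  asymptotic invariance presupposes that late visits are improbable under every density. Under f
  this follows from the law itself with u close to 1: a visit at time n means Z_n = n. For other
  densities it follows from recurrence, and only then can the law be transferred.\<close>

section \<open>Real sequences\<close>

lemma tendsto_ratio_shift_double:
  fixes W :: "nat \<Rightarrow> real"
  assumes pos: "\<And>n. 0 < W n" and W2: "(\<lambda>n. W (2 * n) / W n) \<longlonglongrightarrow> 2"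
  shows "(\<lambda>n. W n / W (2 * n)) \<longlonglongrightarrow> 1 / 2"
  using tendsto_inverse[OF W2] by (simp add: field_simps)

lemma filterlim_div_two: "filterlim (\<lambda>n::nat. n div 2) at_top at_top"
  unfolding filterlim_at_top
proof
  fix Z :: nat
  show "eventually (\<lambda>n. Z \<le> n div 2) sequentially"
    using eventually_ge_at_top[of "2 * Z"] by eventually_elim auto
qed

lemma filterlim_mult_two: "filterlim (\<lambda>n::nat. 2 * n) at_top at_top"
  by (rule mult_nat_left_at_top) simp

text \<open>The block of w over (n, 2n] has sum W (2n) - W n, which is asymptotic to W n, and by
  monotonicity it lies between n w(2n) and n w(n). The upper estimate bounds w n from below
  directly; the lower one bounds w from above at even indices.\<close>

lemma monotone_density_sequence:
  fixes w W :: "nat \<Rightarrow> real"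
  assumes dec: "decseq w" and nonneg: "\<And>n. 0 \<le> w n" and pos: "0 < w 0"
    and W: "\<And>n. W n = (\<Sum>j\<le>n. w j)"
    and W2: "(\<lambda>n. W (2 * n) / W n) \<longlonglongrightarrow> 2"
  shows "(\<lambda>n. real n * w n / W n) \<longlonglongrightarrow> 1"
proof -
  have Wpos: "0 < W n" for n
    using member_le_sum[of 0 "{..n}" w] nonneg pos by (auto simp: W)
  have Wmono: "W m \<le> W n" if "m \<le> n" for m n
    unfolding W using that nonneg by (intro sum_mono2) auto
  have incr: "W (2 * n) - W n = (\<Sum>j\<in>{n<..2 * n}. w j)" for n
  proof -
    have "{..2 * n} = {..n} \<union> {n<..2 * n}" by auto
    then show ?thesis unfolding W by (simp only:) (subst sum.union_disjoint, auto)
  qed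
  have le: "W (2 * n) - W n \<le> real n * w n" for n
    using sum_bounded_above[of "{n<..2 * n}" w "w n"] decseqD[OF dec] unfolding incr by simp
  have ge: "real n * w (2 * n) \<le> W (2 * n) - W n" for n
    using sum_bounded_below[of "{n<..2 * n}" "w (2 * n)" w] decseqD[OF dec] unfolding incr by simp
  have W1: "(\<lambda>n. W n / W (2 * n)) \<longlonglongrightarrow> 1 / 2"
    by (rule tendsto_ratio_shift_double[OF Wpos W2])
  \<comment> \<open>\<open>b k\<close> bounds the quotient at both 2k and 2k + 1, since
    \<open>ge\<close> reaches only even indices. The factor (2k + 1)/k, which pays for n \<le> 2k +
    1, tends to 2, and 1 - W k / W (2k) tends to 1/2.\<close>
  define b where "b k = ((2 * real k + 1) / real k) * (1 - W k / W (2 * k))" for k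
  have "(\<lambda>k. 2 + 1 / real k) \<longlonglongrightarrow> 2 + 0"
    by (intro tendsto_intros lim_1_over_n)
  moreover have "eventually (\<lambda>k. 2 + 1 / real k = (2 * real k + 1) / real k) sequentially"
    using eventually_gt_at_top[of 0] by eventually_elim (simp add: field_simps)
  ultimately have "(\<lambda>k. (2 * real k + 1) / real k) \<longlonglongrightarrow> 2"
    using Lim_transform_eventually by fastforce
  from tendsto_mult[OF this tendsto_diff[OF tendsto_const W1, of 1]]
  have b: "b \<longlonglongrightarrow> 1" unfolding b_def by simp
  have upper: "eventually (\<lambda>n. real n * w n / W n \<le> b (n div 2)) sequentially"
    using eventually_ge_at_top[of 2]
  proof eventually_elim
    case (elim n)
    define k where "k = n div 2"
    have k: "0 < k" "2 * k \<le> n" "n \<le> 2 * k + 1" using elim by (auto simp: k_def)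
    have "real n * w n / W n \<le> (2 * real k + 1) * w (2 * k) / W (2 * k)"
      using k by (intro frac_le mult_mono Wpos Wmono decseqD[OF dec] nonneg mult_nonneg_nonneg) auto
    also have "\<dots> = (2 * real k + 1) / real k * (real k * w (2 * k) / W (2 * k))"
      using k by simp
    also have "\<dots> \<le> (2 * real k + 1) / real k * ((W (2 * k) - W k) / W (2 * k))"
      using ge[of k] Wpos by (intro mult_left_mono divide_right_mono) (auto simp: less_imp_le)
    also have "\<dots> = b k"
      using Wpos[of "2 * k"] by (simp add: b_def diff_divide_distrib)
    finally show ?case by (simp add: k_def)
  qed
  have "W (2 * n) / W n - 1 \<le> real n * w n / W n" for n
    using divide_right_mono[OF le[of n] less_imp_le[OF Wpos[of n]]] Wpos[of n]
    by (simp add: diff_divide_distrib)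
  then have lower: "eventually (\<lambda>n. W (2 * n) / W n - 1 \<le> real n * w n / W n) sequentially"
    by simp
  have "(\<lambda>n. W (2 * n) / W n - 1) \<longlonglongrightarrow> 1"
    using tendsto_diff[OF W2 tendsto_const, of 1] by simp
  with filterlim_compose[OF b filterlim_div_two] show ?thesis
    by (rule tendsto_sandwich[OF lower upper, rotated])
qed

text \<open>Since w n is asymptotic to W n / n, doubling the index does not change w asymptotically.
  For odd n, 2 (n div 2) falls short of n and would bound w n from the wrong side; this is why the
  doubling step is applied twice, as n \<le> 4 (n div 2) for n \<ge> 2.\<close>

lemma slow_variation_of_density:
  fixes w W :: "nat \<Rightarrow> real"
  assumes dec: "decseq w" and pos: "\<And>n. 0 < w n" and Wpos: "\<And>n. 0 < W n"
    and wW: "(\<lambda>n. real n * w n / W n) \<longlonglongrightarrow> 1"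
    and W2: "(\<lambda>n. W (2 * n) / W n) \<longlonglongrightarrow> 2"
  shows "(\<lambda>n. w (n div 2) / w n) \<longlonglongrightarrow> 1"
proof -
  have "(\<lambda>n. (real n * w n / W n) / (real (2 * n) * w (2 * n) / W (2 * n)) * (2 * (W n / W (2 * n)))) \<longlonglongrightarrow> 1 / 1 * (2 * (1 / 2))"
    by (intro tendsto_intros wW filterlim_compose[OF wW filterlim_mult_two]
          tendsto_ratio_shift_double[OF Wpos W2]) simp
  then have "(\<lambda>n. (real n * w n / W n) / (real (2 * n) * w (2 * n) / W (2 * n)) * (2 * (W n / W (2 * n)))) \<longlonglongrightarrow> 1"
    by simp
  moreover have "eventually (\<lambda>n. (real n * w n / W n) / (real (2 * n) * w (2 * n) / W (2 * n)) * (2 * (W n / W (2 * n))) = w n / w (2 * n)) sequentially"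
    using eventually_gt_at_top[of 0]
    by eventually_elim (use pos Wpos in \<open>simp add: field_simps less_imp_neq[THEN not_sym]\<close>)
  ultimately have d: "(\<lambda>n. w n / w (2 * n)) \<longlonglongrightarrow> 1"
    by (simp cong: tendsto_cong)
  from tendsto_mult[OF d filterlim_compose[OF d filterlim_mult_two]]
  have "(\<lambda>n. w n / w (2 * n) * (w (2 * n) / w (2 * (2 * n)))) \<longlonglongrightarrow> 1" by simp
  then have q: "(\<lambda>n. w n / w (2 * (2 * n))) \<longlonglongrightarrow> 1"
    by (rule Lim_transform_eventually)
       (use pos in \<open>simp add: less_imp_neq[THEN not_sym]\<close>)
  show ?thesis
  proof (rule tendsto_sandwich[OF _ _ tendsto_const filterlim_compose[OF q filterlim_div_two]])
    show "eventually (\<lambda>n. 1 \<le> w (n div 2) / w n) sequentially"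
      using decseqD[OF dec] pos by (simp add: le_divide_eq_1)
    show "eventually (\<lambda>n. w (n div 2) / w n \<le> w (n div 2) / w (2 * (2 * (n div 2)))) sequentially"
      using eventually_ge_at_top[of 2]
    proof eventually_elim
      case (elim n)
      then have "n \<le> 2 * (2 * (n div 2))" by linarith
      then show ?case using decseqD[OF dec] pos by (intro divide_left_mono mult_pos_pos) (auto simp: less_imp_le)
    qed
  qed
qed

text \<open>\<open>m n\<close> is the last index at which w is still at least w n / u. Slow
  variation keeps w from jumping past this level and forces m n \<le> n/2, because w is nearly
  constant between n/2 and n. The exact inequalities at \<open>m n\<close> and
  \<open>Suc (m n)\<close> are recorded for comparing events, where the limit of the ratio alone
  would be too weak.\<close>

lemma exists_ratio_index:
  fixes w :: "nat \<Rightarrow> real"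
  assumes dec: "decseq w" and pos: "\<And>n. 0 < w n" and lim: "w \<longlonglongrightarrow> 0"
    and slow: "(\<lambda>n. w (n div 2) / w n) \<longlonglongrightarrow> 1" and u: "0 < u" "u < 1"
  obtains m :: "nat \<Rightarrow> nat" where "filterlim m at_top at_top" "(\<lambda>n. w n / w (m n)) \<longlonglongrightarrow> u"
    "eventually (\<lambda>n. m n < n) sequentially"
    "eventually (\<lambda>n. w n \<le> u * w (m n)) sequentially"
    "eventually (\<lambda>n. u * w (Suc (m n)) < w n) sequentially"
    "eventually (\<lambda>n. m n \<le> n div 2) sequentially"
proof -
  define m where "m n = Max {k. k \<le> n \<and> w n \<le> u * w k}" for n
  have ev: "eventually (\<lambda>n. K \<le> m n) sequentially" for K
  proof -
    have "eventually (\<lambda>n. w n < u * w K) sequentially"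
      using lim u pos by (intro order_tendstoD(2)) auto
    then show ?thesis using eventually_ge_at_top[of K]
    proof eventually_elim
      case (elim n)
      then show ?case unfolding m_def by (intro Max_ge) auto
    qed
  qed
  then have top: "filterlim m at_top at_top"
    by (simp add: filterlim_at_top)
  \<comment> \<open>This puts 0 into the set defining \<open>m n\<close>, so that its
    \<open>Max\<close> is meaningful.\<close>
  have "eventually (\<lambda>n. w n < u * w 0) sequentially"
    using lim u pos by (intro order_tendstoD(2)) auto
  then have props: "eventually (\<lambda>n. w n \<le> u * w (m n) \<and> m n < n \<and> u * w (Suc (m n)) < w n) sequentially"
  proof eventually_elim
    case (elim n)
    have "m n \<in> {k. k \<le> n \<and> w n \<le> u * w k}"
      unfolding m_def using elim by (intro Max_in) auto
    then have 1: "m n \<le> n" "w n \<le> u * w (m n)" by auto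
    have "u * w n < 1 * w n" using u pos by (intro mult_strict_right_mono) auto
    then have "m n \<noteq> n" using 1(2) by auto
    then have 2: "m n < n" using 1 by simp
    have "u * w (Suc (m n)) < w n"
    proof (rule ccontr)
      assume "\<not> ?thesis"
      then have "Suc (m n) \<le> m n"
        using 2 unfolding m_def[of n] by (intro Max_ge) (auto simp flip: m_def)
      then show False by simp
    qed
    then show ?case using 1 2 by auto
  qed
  \<comment> \<open>A single step is controlled by halving: Suc k div 2 \<le> k for k > 0, so w k is
    at most w (Suc k div 2).\<close>
  have "(\<lambda>k. w (Suc k div 2) / w (Suc k)) \<longlonglongrightarrow> 1"
    using slow by (rule LIMSEQ_Suc)
  then have s: "(\<lambda>k. w k / w (Suc k)) \<longlonglongrightarrow> 1"
  proof (rule tendsto_sandwich[rotated 3])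
    show "eventually (\<lambda>k. 1 \<le> w k / w (Suc k)) sequentially"
      using decseqD[OF dec] pos by (simp add: le_divide_eq_1)
    show "eventually (\<lambda>k. w k / w (Suc k) \<le> w (Suc k div 2) / w (Suc k)) sequentially"
      using eventually_gt_at_top[of 0]
      by eventually_elim (use pos in \<open>auto intro!: divide_right_mono decseqD[OF dec] simp: less_imp_le\<close>)
  qed simp
  have "(\<lambda>k. w (Suc k) / w k) \<longlonglongrightarrow> 1"
    using tendsto_inverse[OF s] by simp
  then have "(\<lambda>n. u * (w (Suc (m n)) / w (m n))) \<longlonglongrightarrow> u * 1"
    by (intro tendsto_intros) (rule filterlim_compose[OF _ top])
  then have lo: "(\<lambda>n. u * (w (Suc (m n)) / w (m n))) \<longlonglongrightarrow> u" by simp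
  have ratio: "(\<lambda>n. w n / w (m n)) \<longlonglongrightarrow> u"
  proof (rule tendsto_sandwich[OF _ _ lo tendsto_const])
    show "eventually (\<lambda>n. u * (w (Suc (m n)) / w (m n)) \<le> w n / w (m n)) sequentially"
      using props by eventually_elim (use pos in \<open>auto intro!: divide_right_mono simp: less_imp_le\<close>)
    show "eventually (\<lambda>n. w n / w (m n) \<le> u) sequentially"
      using props by eventually_elim (use pos in \<open>auto simp: pos_divide_le_eq\<close>)
  qed
  have "eventually (\<lambda>n. u < w n / w (n div 2)) sequentially"
    using tendsto_inverse[OF slow] u by (intro order_tendstoD(1)[of _ 1]) auto
  then have "eventually (\<lambda>n. m n \<le> n div 2) sequentially"
    using props
  proof eventually_elim
    case (elim n)
    show ?case
    proof (rule ccontr)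
      assume "\<not> ?thesis"
      then have "w (m n) \<le> w (n div 2)" using decseqD[OF dec] by simp
      with elim u have "w n \<le> u * w (n div 2)"
        by (meson dual_order.trans less_imp_le mult_left_mono)
      with elim pos[of "n div 2"] show False by (simp add: pos_less_divide_eq)
    qed
  qed
  then show ?thesis
    using props top ratio by (intro that[of m]) (auto elim: eventually_mono)
qed

text \<open>The error factors stand on both sides so that relative estimates can be used without
  division. As \<epsilon> tends to 0, (1 + \<epsilon>)/(1 - \<epsilon>) u tends to u, so some fixed
  \<epsilon> already separates it from any prescribed b.\<close>

lemma relative_squeeze:
  fixes lo hi x :: "nat \<Rightarrow> real"
  assumes lo: "lo \<longlonglongrightarrow> u" and hi: "hi \<longlonglongrightarrow> u"
    and lower: "\<And>\<epsilon>. \<lbrakk>0 < \<epsilon>; \<epsilon> < 1\<rbrakk> \<Longrightarrow> eventually (\<lambda>n. (1 - \<epsilon>) * lo n \<le> (1 + \<epsilon>) * x n) sequentially"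
    and upper: "\<And>\<epsilon>. \<lbrakk>0 < \<epsilon>; \<epsilon> < 1\<rbrakk> \<Longrightarrow> eventually (\<lambda>n. (1 - \<epsilon>) * x n \<le> (1 + \<epsilon>) * hi n) sequentially"
  shows "x \<longlonglongrightarrow> u"
proof (rule order_tendstoI)
  fix b assume "u < b"
  have "((\<lambda>\<epsilon>. (1 + \<epsilon>) / (1 - \<epsilon>) * u) \<longlongrightarrow> (1 + 0) / (1 - 0) * u) (at_right 0)"
    by (intro tendsto_intros) auto
  then have "eventually (\<lambda>\<epsilon>. (1 + \<epsilon>) / (1 - \<epsilon>) * u < b) (at_right 0)"
    using \<open>u < b\<close> by (intro order_tendstoD(2)) auto
  moreover have "eventually (\<lambda>\<epsilon>::real. \<epsilon> \<in> {0<..<1}) (at_right 0)"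
    by (rule eventually_at_right_real) simp
  ultimately have "eventually (\<lambda>\<epsilon>. (1 + \<epsilon>) / (1 - \<epsilon>) * u < b \<and> \<epsilon> \<in> {0<..<1}) (at_right 0)"
    by (rule eventually_conj)
  then obtain \<epsilon> where \<epsilon>: "(1 + \<epsilon>) / (1 - \<epsilon>) * u < b" "0 < \<epsilon>" "\<epsilon> < 1"
    using eventually_happens[of _ "at_right (0::real)"] by auto
  have "(\<lambda>n. (1 + \<epsilon>) / (1 - \<epsilon>) * hi n) \<longlonglongrightarrow> (1 + \<epsilon>) / (1 - \<epsilon>) * u"
    by (intro tendsto_intros hi)
  then have "eventually (\<lambda>n. (1 + \<epsilon>) / (1 - \<epsilon>) * hi n < b) sequentially"
    using \<epsilon>(1) by (rule order_tendstoD)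
  then show "eventually (\<lambda>n. x n < b) sequentially"
    using upper[OF \<epsilon>(2,3)]
  proof eventually_elim
    case (elim n)
    have "x n \<le> (1 + \<epsilon>) / (1 - \<epsilon>) * hi n" using elim(2) \<epsilon> by (simp add: field_simps)
    then show ?case using elim(1) by simp
  qed
next
  fix b assume "b < u"
  have "((\<lambda>\<epsilon>. (1 - \<epsilon>) / (1 + \<epsilon>) * u) \<longlongrightarrow> (1 - 0) / (1 + 0) * u) (at_right 0)"
    by (intro tendsto_intros) auto
  then have "eventually (\<lambda>\<epsilon>. b < (1 - \<epsilon>) / (1 + \<epsilon>) * u) (at_right 0)"
    using \<open>b < u\<close> by (intro order_tendstoD(1)) auto
  moreover have "eventually (\<lambda>\<epsilon>::real. \<epsilon> \<in> {0<..<1}) (at_right 0)"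
    by (rule eventually_at_right_real) simp
  ultimately have "eventually (\<lambda>\<epsilon>. b < (1 - \<epsilon>) / (1 + \<epsilon>) * u \<and> \<epsilon> \<in> {0<..<1}) (at_right 0)"
    by (rule eventually_conj)
  then obtain \<epsilon> where \<epsilon>: "b < (1 - \<epsilon>) / (1 + \<epsilon>) * u" "0 < \<epsilon>" "\<epsilon> < 1"
    using eventually_happens[of _ "at_right (0::real)"] by auto
  have "(\<lambda>n. (1 - \<epsilon>) / (1 + \<epsilon>) * lo n) \<longlonglongrightarrow> (1 - \<epsilon>) / (1 + \<epsilon>) * u"
    by (intro tendsto_intros lo)
  then have "eventually (\<lambda>n. b < (1 - \<epsilon>) / (1 + \<epsilon>) * lo n) sequentially"
    using \<epsilon>(1) by (rule order_tendstoD)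
  then show "eventually (\<lambda>n. b < x n) sequentially"
    using lower[OF \<epsilon>(2,3)]
  proof eventually_elim
    case (elim n)
    have "(1 - \<epsilon>) / (1 + \<epsilon>) * lo n \<le> x n" using elim(2) \<epsilon> by (simp add: field_simps)
    then show ?case using elim(1) by simp
  qed
qed

text \<open>Half of \<delta> absorbs the distance of the late terms from 1, the other half the K
  discarded initial terms, once N \<ge> 2K/\<delta>.\<close>

lemma eventually_partial_sum_ge:
  fixes q :: "nat \<Rightarrow> real"
  assumes q: "q \<longlonglongrightarrow> 1" and nonneg: "\<And>n. 0 \<le> q n" and \<delta>: "0 < \<delta>" "\<delta> < 1"
  shows "eventually (\<lambda>N. (1 - \<delta>) * real N \<le> (\<Sum>n\<le>N. q n)) sequentially"
proof -
  have "eventually (\<lambda>n. 1 - \<delta> / 2 < q n) sequentially"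
    using q \<delta> by (intro order_tendstoD(1)) auto
  then obtain K where K: "\<And>n. n \<ge> K \<Longrightarrow> 1 - \<delta> / 2 < q n" by (auto simp: eventually_sequentially)
  show ?thesis
    using eventually_ge_at_top[of "max K (nat \<lceil>2 * real K / \<delta>\<rceil>)"]
  proof eventually_elim
    case (elim N)
    have "2 * real K / \<delta> \<le> real N" using elim by linarith
    then have K2: "2 * real K \<le> \<delta> * real N" using \<delta> by (simp add: field_simps)
    have "(1 - \<delta>) * real N \<le> (real N + 1 - real K) * (1 - \<delta> / 2)"
    proof -
      have "(real N + 1 - real K) * (1 - \<delta> / 2) - (1 - \<delta>) * real N = (\<delta> * real N - 2 * real K) / 2 + real K * \<delta> / 2 + (1 - \<delta> / 2)"
        by (simp add: field_simps)
      moreover have "0 \<le> \<dots>" using K2 \<delta> by (intro add_nonneg_nonneg) auto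
      ultimately show ?thesis by linarith
    qed
    also have "\<dots> = (\<Sum>n\<in>{K..N}. 1 - \<delta> / 2)" using elim by (simp add: of_nat_diff)
    also have "\<dots> \<le> (\<Sum>n\<in>{K..N}. q n)" using K by (intro sum_mono) (auto simp: less_imp_le)
    also have "\<dots> \<le> (\<Sum>n\<le>N. q n)" using nonneg by (intro sum_mono2) auto
    finally show ?case .
  qed
qed

lemma separating_factor:
  fixes p q :: real
  assumes "0 < p" "p < q"
  obtains \<epsilon> where "0 < \<epsilon>" "\<epsilon> < 1" "(1 + \<epsilon>) * p \<le> (1 - \<epsilon>) * q"
\<comment> \<open>With this choice both sides equal 2pq/(p + q), the harmonic mean of p and
  q.\<close>
proof (rule that[of "(q - p) / (q + p)"])
  show "(1 + (q - p) / (q + p)) * p \<le> (1 - (q - p) / (q + p)) * q"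
    using assms by (simp add: field_simps)
qed (use assms in auto)

section \<open>Weak limits obtained from almost norm-minimal convex combinations\<close>

section \<open>Weak cluster points of uniformly bounded functions\<close>

text \<open>With weight p bounded functions become square-integrable although the measure may be
  infinite, and strict positivity ensures that no set of positive measure is overlooked.\<close>

lemma (in sigma_finite_measure) positive_integrable_weight:
  shows "\<exists>p :: 'a \<Rightarrow> real. integrable M p \<and> (\<forall>x\<in>space M. 0 < p x) \<and> (\<forall>x. 0 \<le> p x)"
proof -
  obtain h where h: "h \<in> borel_measurable M" "integral\<^sup>N M h \<noteq> \<infinity>"
    "\<And>x. x \<in> space M \<Longrightarrow> 0 < h x \<and> h x < \<infinity>"
    using Ex_finite_integrable_function by blast
  show ?thesis
  proof (intro exI[of _ "\<lambda>x. enn2real (h x)"] conjI ballI allI)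
    have "(\<integral>\<^sup>+x. ennreal (enn2real (h x)) \<partial>M) = integral\<^sup>N M h"
      using h(3) by (intro nn_integral_cong) simp
    then show "integrable M (\<lambda>x. enn2real (h x))"
      using h by (intro integrableI_nonneg) (auto simp: top.not_eq_extremum)
    show "0 < enn2real (h x)" if "x \<in> space M" for x
      using h(3)[OF that] by (simp add: enn2real_positive_iff)
  qed simp
qed

lemma integrable_unit_interval_mult:
  fixes g h :: "'a \<Rightarrow> real"
  assumes "integrable M h" "g \<in> borel_measurable M" "\<And>x. 0 \<le> g x" "\<And>x. g x \<le> 1"
  shows "integrable M (\<lambda>x. g x * h x)"
proof (rule Bochner_Integration.integrable_bound[OF assms(1)])
  show "AE x in M. norm (g x * h x) \<le> norm (h x)"
    using assms(3,4) by (simp add: abs_mult mult_left_le_one_le)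
qed (use assms in measurable)

text \<open>
  This replaces weak-* compactness of the unit ball of $L_\infty$. The set \<open>C N\<close> in the proof is the
  closed convex hull of \<open>{\<phi> n | n \<ge> N}\<close>, described by its supporting half-spaces. By the parallelogram
  law, almost norm-minimal elements of these decreasing sets form a Cauchy sequence in weighted $L_2$.
\<close>

lemma (in sigma_finite_measure) weak_cluster_point:
  fixes \<phi> :: "nat \<Rightarrow> 'a \<Rightarrow> real"
  assumes meas: "\<And>n. \<phi> n \<in> borel_measurable M"
    and lo: "\<And>n x. 0 \<le> \<phi> n x" and hi: "\<And>n x. \<phi> n x \<le> 1"
  obtains g where "g \<in> borel_measurable M" "\<And>x. 0 \<le> g x" "\<And>x. g x \<le> 1"
    "\<And>h c. \<lbrakk>integrable M h; eventually (\<lambda>n. (\<integral>x. \<phi> n x * h x \<partial>M) \<le> c) sequentially\<rbrakk>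
        \<Longrightarrow> (\<integral>x. g x * h x \<partial>M) \<le> c"
proof -
  obtain p :: "'a \<Rightarrow> real" where p: "integrable M p" "\<And>x. x \<in> space M \<Longrightarrow> 0 < p x" "\<And>x. 0 \<le> p x"
    using positive_integrable_weight by auto
  define q where "q g = (\<integral>x. (g x)\<^sup>2 * p x \<partial>M)" for g :: "'a \<Rightarrow> real"
  define K where "K N g \<longleftrightarrow>
    (\<forall>h c. integrable M h \<longrightarrow> (\<forall>n\<ge>N. (\<integral>x. \<phi> n x * h x \<partial>M) \<le> c) \<longrightarrow> (\<integral>x. g x * h x \<partial>M) \<le> c)"
    for N :: nat and g
  define C where "C N = {g. g \<in> borel_measurable M \<and> (\<forall>x. 0 \<le> g x \<and> g x \<le> 1) \<and> K N g}" for N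
  have KI: "K N g" if "\<And>h c. \<lbrakk>integrable M h; \<And>n. n \<ge> N \<Longrightarrow> (\<integral>x. \<phi> n x * h x \<partial>M) \<le> c\<rbrakk> \<Longrightarrow> (\<integral>x. g x * h x \<partial>M) \<le> c"
    for N g
    unfolding K_def by (intro allI impI that) auto
  have KD: "(\<integral>x. g x * h x \<partial>M) \<le> c"
    if "K N g" "integrable M h" "\<And>n. n \<ge> N \<Longrightarrow> (\<integral>x. \<phi> n x * h x \<partial>M) \<le> c" for g N h c
    using that(1)[unfolded K_def, rule_format, OF that(2)] that(3) by simp
  have CD: "g \<in> borel_measurable M" "0 \<le> g x" "g x \<le> 1" "K N g" if "g \<in> C N" for g N x
    using that by (auto simp: C_def)
  note CI = KD[OF CD(4)]
  have C_int: "integrable M (\<lambda>x. g x * h x)" if "g \<in> C N" "integrable M h" for g h N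
    by (rule integrable_unit_interval_mult[OF that(2) CD(1-3)[OF that(1)]])
  have \<phi>C: "\<phi> N \<in> C N" for N
    using meas lo hi by (auto simp: C_def intro!: KI)
  have C_mono: "C N \<subseteq> C N'" if "N' \<le> N" for N N'
  proof
    fix g assume "g \<in> C N"
    from CI[OF this] that have "K N' g" by (intro KI) auto
    then show "g \<in> C N'" using CD[OF \<open>g \<in> C N\<close>] by (simp add: C_def)
  qed
  have mid: "(\<lambda>x. (g x + g' x) / 2) \<in> C N" if g: "g \<in> C N" and g': "g' \<in> C N" for g g' N
  proof -
    have "(\<integral>x. (g x + g' x) / 2 * h x \<partial>M) \<le> c"
      if h: "integrable M h" and c: "\<And>n. n \<ge> N \<Longrightarrow> (\<integral>x. \<phi> n x * h x \<partial>M) \<le> c" for h c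
    proof -
      have "(\<integral>x. (g x + g' x) / 2 * h x \<partial>M) = (\<integral>x. (g x * h x + g' x * h x) / 2 \<partial>M)"
        by (intro Bochner_Integration.integral_cong) (auto simp: field_simps)
      also have "\<dots> = ((\<integral>x. g x * h x \<partial>M) + (\<integral>x. g' x * h x \<partial>M)) / 2"
        using C_int[OF g h] C_int[OF g' h] by simp
      also have "\<dots> \<le> (c + c) / 2"
        using CI[OF g h] CI[OF g' h] c by (intro divide_right_mono add_mono) auto
      finally show ?thesis by simp
    qed
    then have "K N (\<lambda>x. (g x + g' x) / 2)" by (rule KI)
    moreover have "0 \<le> (g x + g' x) / 2 \<and> (g x + g' x) / 2 \<le> 1" for x
      using CD(2,3)[OF g, of x] CD(2,3)[OF g', of x] by auto
    moreover have "(\<lambda>x. (g x + g' x) / 2) \<in> borel_measurable M"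
      using CD(1)[OF g] CD(1)[OF g'] by measurable
    ultimately show ?thesis by (simp add: C_def)
  qed
  have sq_int: "integrable M (\<lambda>x. (g x)\<^sup>2 * p x)" if "g \<in> borel_measurable M" "\<And>x. \<bar>g x\<bar> \<le> 1" for g
    using that by (intro integrable_unit_interval_mult p(1)) (auto simp: abs_square_le_1)
  have abs_le_1: "\<bar>g x\<bar> \<le> 1" if "g \<in> C N" for g N x
    using CD(2,3)[OF that, of x] by simp
  have diff_le_1: "\<bar>g x - g' x\<bar> \<le> 1" if "g \<in> C N" "g' \<in> C N'" for g g' N N' x
    using CD(2,3)[OF that(1), of x] CD(2,3)[OF that(2), of x] by auto
  define d where "d N = Inf (q ` C N)" for N
  have q_nonneg: "0 \<le> q g" for g unfolding q_def using p(3) by simp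
  have bdd: "bdd_below (q ` C N)" for N
    by (rule bdd_belowI2[where m = 0]) (rule q_nonneg)
  have d_le: "d N \<le> q g" if "g \<in> C N" for g N
    unfolding d_def using bdd that by (intro cInf_lower) auto
  have d_mono: "d N \<le> d N'" if "N \<le> N'" for N N'
    unfolding d_def using bdd C_mono[OF that] \<phi>C[of N'] by (intro cInf_superset_mono) auto
  have d_bound: "d N \<le> (\<integral>x. p x \<partial>M)" for N
  proof -
    have "d N \<le> q (\<phi> N)" by (rule d_le[OF \<phi>C])
    also have "\<dots> \<le> (\<integral>x. p x \<partial>M)"
      unfolding q_def using p(3) abs_le_1[OF \<phi>C] CD(1)[OF \<phi>C]
      by (intro integral_mono sq_int p(1)) (auto simp: mult_left_le_one_le abs_square_le_1)
    finally show ?thesis .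
  qed
  obtain l where "d \<longlonglongrightarrow> l"
    using incseq_convergent[of d "\<integral>x. p x \<partial>M"] d_mono d_bound by (metis incseq_def)
  then have d_Cauchy: "Cauchy d" by (rule LIMSEQ_imp_Cauchy)
  have "\<exists>g. g \<in> C N \<and> q g < d N + 1 / Suc N" for N
    using cInf_lessD[of "q ` C N" "d N + 1 / Suc N"] \<phi>C[of N] by (auto simp: d_def)
  then obtain G where G: "\<And>N. G N \<in> C N" "\<And>N. q (G N) < d N + 1 / Suc N"
    by metis
  \<comment> \<open>N \<le> N' puts \<open>G N'\<close> into \<open>C N\<close>, hence also the
    midpoint of \<open>G N\<close> and \<open>G N'\<close>, whose \<open>q\<close> is then at least
    \<open>d N\<close>. Near-minimality of both functions leaves little for their difference in the
    parallelogram law.\<close>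
  have par: "q (\<lambda>x. G N x - G N' x) \<le> 2 * (d N' - d N) + 4 / Suc N" if "N \<le> N'" for N N'
  proof -
    have G': "G N' \<in> C N" using G(1) C_mono[OF that] by blast
    have "q (\<lambda>x. G N x - G N' x) = (\<integral>x. 2 * ((G N x)\<^sup>2 * p x) + 2 * ((G N' x)\<^sup>2 * p x) - 4 * (((G N x + G N' x) / 2)\<^sup>2 * p x) \<partial>M)"
      unfolding q_def by (intro Bochner_Integration.integral_cong) (auto simp: power2_eq_square field_simps)
    also have "\<dots> = 2 * q (G N) + 2 * q (G N') - 4 * q (\<lambda>x. (G N x + G N' x) / 2)"
      unfolding q_def
      using sq_int[OF CD(1)[OF G(1)] abs_le_1[OF G(1)]] sq_int[OF CD(1)[OF mid[OF G(1) G']] abs_le_1[OF mid[OF G(1) G']]]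
      by simp
    also have "\<dots> \<le> 2 * (d N + 1 / Suc N) + 2 * (d N' + 1 / Suc N) - 4 * d N"
    proof -
      have "q (G N') \<le> d N' + 1 / Suc N"
        using G(2)[of N'] that frac_le[of 1 1 "real (Suc N)" "real (Suc N')"] by (simp del: of_nat_Suc)
      moreover have "2 * a + 2 * b - 4 * c \<le> 2 * (d N + s) + 2 * (d N' + s) - 4 * d N"
        if "b \<le> d N' + s" "a < d N + s" "d N \<le> c" for a b c s
        using that by argo
      ultimately show ?thesis
        using G(2)[of N] d_le[OF mid[OF G(1) G']] by blast
    qed
    finally show ?thesis by (simp add: algebra_simps)
  qed
  \<comment> \<open>The step from weighted L2 to weighted L1 rests on |g| \<le> e +
    \<open>(g x)^2 / e\<close>, with e still free to be balanced against \<open>q g\<close>.\<close>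
  have L1: "(\<integral>x. norm (g x * p x) \<partial>M) \<le> e * (\<integral>x. p x \<partial>M) + q g / e"
    if "g \<in> borel_measurable M" "\<And>x. \<bar>g x\<bar> \<le> 1" "0 < e" for g e
  proof -
    have "(\<integral>x. norm (g x * p x) \<partial>M) \<le> (\<integral>x. e * p x + ((g x)\<^sup>2 * p x) / e \<partial>M)"
    proof (rule integral_mono_AE')
      have "norm (g x * p x) \<le> e * p x + ((g x)\<^sup>2 * p x) / e" for x
      proof -
        have "2 * (e * \<bar>g x\<bar>) \<le> e\<^sup>2 + (g x)\<^sup>2"
          using sum_squares_ge_zero[of "e - \<bar>g x\<bar>" 0] by (simp add: power2_eq_square algebra_simps)
        then have "e * \<bar>g x\<bar> \<le> e\<^sup>2 + (g x)\<^sup>2"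
          using \<open>0 < e\<close> by (smt (verit) mult_nonneg_nonneg abs_ge_zero)
        then have "\<bar>g x\<bar> \<le> e + (g x)\<^sup>2 / e"
          using \<open>0 < e\<close> by (simp add: field_simps power2_eq_square)
        from mult_right_mono[OF this p(3)[of x]] show ?thesis
          using p(3)[of x] by (simp add: abs_mult field_simps)
      qed
      then show "AE x in M. norm (g x * p x) \<le> e * p x + ((g x)\<^sup>2 * p x) / e" by simp
      show "integrable M (\<lambda>x. e * p x + ((g x)\<^sup>2 * p x) / e)"
        using p(1) sq_int[OF that(1,2)] by auto
    qed (use p(3) that(3) in auto)
    also have "\<dots> = e * (\<integral>x. p x \<partial>M) + q g / e"
      using p(1) sq_int[OF that(1,2)] by (simp add: q_def)
    finally show ?thesis .
  qed
  have q_swap: "q (\<lambda>x. G N x - G N' x) = q (\<lambda>x. G N' x - G N x)" for N N'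
    unfolding q_def by (simp add: power2_commute)
  have "\<exists>N. \<forall>i\<ge>N. \<forall>j\<ge>N. (LINT x|M. norm (G i x * p x - G j x * p x)) < e" if "0 < e" for e :: real
  proof -
    define I where "I = (\<integral>x. p x \<partial>M)"
    have "0 \<le> I" unfolding I_def using p(3) by simp
    \<comment> \<open>Half of e goes to \<delta> * I, where the 1 in the denominator covers I = 0;
      the other half goes to q / \<delta>, which requires q \<le> \<delta> * e / 2.\<close>
    define \<delta> where "\<delta> = e / (2 * (I + 1))"
    have \<delta>: "0 < \<delta>" "\<delta> * I < e / 2"
      using \<open>0 \<le> I\<close> that by (auto simp: \<delta>_def field_simps)
    \<comment> \<open>The fractions fit \<open>par\<close>: both 2 (d j - d i) and 4 / Suc i are
      then at most \<delta> * e / 4.\<close>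
    have \<delta>e: "0 < \<delta> * e / 8" "0 < \<delta> * e / 16" using \<delta>(1) that by auto
    obtain N1 where N1: "\<And>i j. i \<ge> N1 \<Longrightarrow> j \<ge> N1 \<Longrightarrow> norm (d i - d j) < \<delta> * e / 8"
      using CauchyD[OF d_Cauchy \<delta>e(1)] by blast
    obtain N2 where N2: "inverse (real (Suc N2)) < \<delta> * e / 16"
      using reals_Archimedean[OF \<delta>e(2)] by blast
    have main: "q (\<lambda>x. G i x - G j x) \<le> \<delta> * e / 2" if "i \<ge> max N1 N2" "j \<ge> i" for i j
    proof -
      have "1 / real (Suc i) \<le> inverse (real (Suc N2))"
        using that by (simp add: inverse_eq_divide frac_le)
      then have "4 / real (Suc i) \<le> \<delta> * e / 4" using N2 by simp
      moreover have "\<bar>d j - d i\<bar> < \<delta> * e / 8" using N1[of j i] that by (simp only: real_norm_def)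
      ultimately show ?thesis using par[OF that(2)] unfolding abs_less_iff by argo
    qed
    have "(LINT x|M. norm (G i x * p x - G j x * p x)) < e" if "i \<ge> max N1 N2" "j \<ge> max N1 N2" for i j
    proof -
      have "(LINT x|M. norm (G i x * p x - G j x * p x)) = (LINT x|M. norm ((G i x - G j x) * p x))"
        by (simp add: left_diff_distrib)
      also have "\<dots> \<le> \<delta> * I + q (\<lambda>x. G i x - G j x) / \<delta>"
        unfolding I_def using diff_le_1[OF G(1) G(1)] CD(1)[OF G(1)] \<delta>(1) by (intro L1) auto
      also have "q (\<lambda>x. G i x - G j x) \<le> \<delta> * e / 2"
        using main[of i j] main[of j i] that q_swap[of i j] by (cases "i \<le> j") auto
      then have "q (\<lambda>x. G i x - G j x) / \<delta> \<le> e / 2"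
        using \<delta> by (simp add: field_simps)
      finally show ?thesis using \<delta>(2) by linarith
    qed
    then show ?thesis by blast
  qed
  then obtain r where r: "strict_mono r" "AE x in M. Cauchy (\<lambda>i. G (r i) x * p x)"
    using cauchy_L1_AE_cauchy_subseq[of M "\<lambda>i x. G i x * p x"] C_int[OF G(1) p(1)] by blast
  \<comment> \<open>The default 0 at points of divergence keeps the bounds 0 and 1 valid everywhere,
    not only almost everywhere.\<close>
  define g where "g x = (if convergent (\<lambda>i. G (r i) x) then lim (\<lambda>i. G (r i) x) else 0)" for x
  have conv: "AE x in M. (\<lambda>i. G (r i) x) \<longlonglongrightarrow> g x"
    using r(2) AE_space
  proof eventually_elim
    case (elim x)
    then obtain l where l: "(\<lambda>i. G (r i) x * p x) \<longlonglongrightarrow> l"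
      by (auto simp: Cauchy_convergent_iff convergent_def)
    have "p x \<noteq> 0" using p(2)[OF elim(2)] by simp
    from tendsto_divide[OF l tendsto_const this] this have "(\<lambda>i. G (r i) x) \<longlonglongrightarrow> l / p x" by simp
    then have "convergent (\<lambda>i. G (r i) x)" by (rule convergentI)
    then show ?case by (simp add: g_def convergent_LIMSEQ_iff)
  qed
  have g_meas: "g \<in> borel_measurable M"
    unfolding g_def Cauchy_convergent_iff[symmetric] using CD(1)[OF G(1)] by measurable
  have lims: "0 \<le> lim (\<lambda>i. G (r i) x) \<and> lim (\<lambda>i. G (r i) x) \<le> 1" if "convergent (\<lambda>i. G (r i) x)" for x
    using that[unfolded convergent_LIMSEQ_iff] CD(2,3)[OF G(1)]
    by (auto intro: LIMSEQ_le_const LIMSEQ_le_const2)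
  show ?thesis
  proof (rule that[OF g_meas])
    show "0 \<le> g x" "g x \<le> 1" for x using lims by (auto simp: g_def)
    fix h :: "'a \<Rightarrow> real" and c
    assume h: "integrable M h" and "eventually (\<lambda>n. (\<integral>x. \<phi> n x * h x \<partial>M) \<le> c) sequentially"
    then obtain N where N: "\<And>n. n \<ge> N \<Longrightarrow> (\<integral>x. \<phi> n x * h x \<partial>M) \<le> c"
      by (auto simp: eventually_sequentially)
    have "(\<lambda>i. \<integral>x. G (r i) x * h x \<partial>M) \<longlonglongrightarrow> (\<integral>x. g x * h x \<partial>M)"
    proof (rule integral_dominated_convergence)
      show "integrable M (\<lambda>x. \<bar>h x\<bar>)" using h by simp
      show "AE x in M. (\<lambda>i. G (r i) x * h x) \<longlonglongrightarrow> g x * h x"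
        using conv by eventually_elim (intro tendsto_intros)
      show "AE x in M. norm (G (r i) x * h x) \<le> \<bar>h x\<bar>" for i
        using CD(2,3)[OF G(1)] by (simp add: abs_mult mult_left_le_one_le)
    qed (use g_meas h CD(1)[OF G(1)] in measurable)
    moreover have "eventually (\<lambda>i. (\<integral>x. G (r i) x * h x \<partial>M) \<le> c) sequentially"
      using eventually_ge_at_top[of N]
    proof eventually_elim
      case (elim i)
      then have "N \<le> r i" using seq_suble[OF r(1), of i] by linarith
      then show ?case using CI[OF G(1)[of "r i"] h] N by simp
    qed
    ultimately show "(\<integral>x. g x * h x \<partial>M) \<le> c"
      by (intro tendsto_upperbound) auto
  qed
qed

section \<open>Consequences of conservativity and ergodicity: almost every orbit returns to every
  non-null set\<close>

section \<open>Recurrence and ergodicity\<close>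

text \<open>Take for h the positive weight p restricted to the set where g' < g. The integral of (g
  - g') h is then both nonnegative and nonpositive, which makes that set null.\<close>

lemma (in sigma_finite_measure) AE_le_if_integral_mult_le:
  fixes g g' :: "'a \<Rightarrow> real"
  assumes g: "g \<in> borel_measurable M" "\<And>x. 0 \<le> g x" "\<And>x. g x \<le> 1"
    and g': "g' \<in> borel_measurable M" "\<And>x. 0 \<le> g' x" "\<And>x. g' x \<le> 1"
    and le: "\<And>h. \<lbrakk>integrable M h; \<And>x. 0 \<le> h x\<rbrakk> \<Longrightarrow> (\<integral>x. g x * h x \<partial>M) \<le> (\<integral>x. g' x * h x \<partial>M)"
  shows "AE x in M. g x \<le> g' x"
proof -
  note [measurable] = g(1) g'(1)
  obtain p :: "'a \<Rightarrow> real" where p: "integrable M p" "\<forall>x\<in>space M. 0 < p x" "\<forall>x. 0 \<le> p x"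
    using positive_integrable_weight by blast
  note [measurable] = borel_measurable_integrable[OF p(1)]
  define h where "h x = indicator {x \<in> space M. g' x < g x} x * p x" for x
  have h: "integrable M h" "\<And>x. 0 \<le> h x"
    unfolding h_def using p by (auto intro!: integrable_unit_interval_mult simp: indicator_def)
  have i: "integrable M (\<lambda>x. g x * h x)" "integrable M (\<lambda>x. g' x * h x)"
    using integrable_unit_interval_mult[OF h(1)] g g' by blast+
  have nn: "0 \<le> g x * h x - g' x * h x" for x
    using p(3) by (auto simp: h_def indicator_def mult_right_mono)
  have "(\<integral>x. g x * h x - g' x * h x \<partial>M) = 0"
    using i le[OF h] nn by (intro antisym integral_nonneg_AE) auto
  then have "AE x in M. g x * h x - g' x * h x = 0"
    using i nn by (subst (asm) integral_nonneg_eq_0_iff_AE) auto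
  then show ?thesis
    using AE_space
  proof eventually_elim
    case (elim x)
    then show ?case using p(2) by (cases "g' x < g x") (auto simp: h_def indicator_def)
  qed
qed

context conservative_ergodic_system
begin

lemma measurable_funpow [measurable]: "T ^^ n \<in> measurable M M"
proof (induction n)
  case (Suc n)
  then show ?case using measurable_compose[OF Suc measurable_T] by (simp add: comp_def)
qed (simp add: id_def)

lemma funpow_in_space: "x \<in> space M \<Longrightarrow> (T ^^ n) x \<in> space M"
  using measurable_space[OF measurable_funpow] .

lemma emeasure_vimage_funpow:
  "B \<in> sets M \<Longrightarrow> emeasure M ((T ^^ n) -` B \<inter> space M) = emeasure M B"
proof (induction n arbitrary: B)
  case (Suc n)
  have "(T ^^ Suc n) -` B \<inter> space M = (T ^^ n) -` (T -` B \<inter> space M) \<inter> space M"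
    using funpow_in_space[of _ n] by auto
  then show ?case
    using Suc.IH[OF measurable_sets[OF measurable_T Suc.prems]] preserving[OF Suc.prems] by argo
qed (simp add: sets.Int_space_eq2)

lemma AE_funpow:
  assumes "AE x in M. Q x" shows "AE x in M. Q ((T ^^ n) x)"
proof -
  obtain N where N: "N \<in> null_sets M" "{x \<in> space M. \<not> Q x} \<subseteq> N"
    using assms by (auto elim!: AE_E)
  have "(T ^^ n) -` N \<inter> space M \<in> null_sets M"
    using N(1) emeasure_vimage_funpow[of N n] measurable_sets[OF measurable_funpow, of N n]
    by (auto simp: null_sets_def)
  then show ?thesis
    by (rule AE_I') (use N(2) funpow_in_space in auto)
qed

text \<open>An orbit can meet this set at most once, because a second meeting would be a return to
  B. Its preimages are therefore disjoint, and conservativity applies.\<close>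

lemma never_returning_null:
  assumes [measurable]: "B \<in> sets M"
  shows "{x \<in> B. \<forall>k>0. (T ^^ k) x \<notin> B} \<in> null_sets M"
proof -
  let ?D = "{x \<in> B. \<forall>k>0. (T ^^ k) x \<notin> B}"
  have sp: "B \<subseteq> space M" by (rule sets.sets_into_space[OF assms])
  then have "?D = {x \<in> space M. x \<in> B \<and> (\<forall>k>0. (T ^^ k) x \<notin> B)}" by auto
  also have "\<dots> \<in> sets M" by measurable
  finally have D: "?D \<in> sets M" .
  have False if "i < j" "(T ^^ i) x \<in> ?D" "(T ^^ j) x \<in> ?D" for i j x
  proof -
    have "(T ^^ j) x = (T ^^ (j - i)) ((T ^^ i) x)"
      using that(1) funpow_add[of "j - i" i T] by simp
    then show False using that by auto
  qed
  then have "i = j" if "(T ^^ i) x \<in> ?D" "(T ^^ j) x \<in> ?D" for i j x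
    using that by (cases i j rule: linorder_cases) blast+
  then have "disjoint_family (\<lambda>n. (T ^^ n) -` ?D \<inter> space M)"
    unfolding disjoint_family_on_def by blast
  from conservative[OF D this] D show ?thesis by auto
qed

text \<open>The set I of points visiting B infinitely often is strictly invariant, so by ergodicity
  it is either conull, as desired, or null. In the second case B itself would be null.\<close>

lemma recurrence:
  assumes [measurable]: "B \<in> sets M" and pos: "emeasure M B \<noteq> 0"
  shows "AE x in M. \<forall>n. \<exists>k\<ge>n. (T ^^ k) x \<in> B"
proof -
  define D where "D = {x \<in> B. \<forall>k>0. (T ^^ k) x \<notin> B}"
  define I where "I = {x \<in> space M. \<forall>n. \<exists>k\<ge>n. (T ^^ k) x \<in> B}"
  have D: "D \<in> null_sets M" unfolding D_def by (rule never_returning_null) fact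
  have I [measurable]: "I \<in> sets M" unfolding I_def by measurable
  have "x \<in> I \<longleftrightarrow> T x \<in> I" if x: "x \<in> space M" for x
  proof -
    have Tx: "T x \<in> space M" using measurable_space[OF measurable_T x] .
    have "(\<forall>n. \<exists>k\<ge>n. (T ^^ k) x \<in> B) \<longleftrightarrow> (\<forall>n. \<exists>k\<ge>n. (T ^^ k) (T x) \<in> B)"
    proof (intro iffI allI)
      fix n assume "\<forall>n. \<exists>k\<ge>n. (T ^^ k) x \<in> B"
      then obtain k where "k \<ge> Suc n" "(T ^^ k) x \<in> B" by blast
      then show "\<exists>k\<ge>n. (T ^^ k) (T x) \<in> B"
        by (intro exI[of _ "k - 1"]) (cases k, auto simp: funpow_swap1)
    next
      fix n assume "\<forall>n. \<exists>k\<ge>n. (T ^^ k) (T x) \<in> B"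
      then obtain k where "k \<ge> n" "(T ^^ k) (T x) \<in> B" by blast
      then show "\<exists>k\<ge>n. (T ^^ k) x \<in> B"
        by (intro exI[of _ "Suc k"]) (auto simp: funpow_swap1)
    qed
    then show ?thesis using x Tx by (simp add: I_def)
  qed
  then have "T -` I \<inter> space M = I" using sets.sets_into_space[OF I] by auto
  from ergodic[OF I this] show ?thesis
  proof
    assume "emeasure M (space M - I) = 0"
    then have "space M - I \<in> null_sets M" using I by auto
    then show ?thesis by (rule AE_I') (auto simp: I_def)
  next
    assume I0: "emeasure M I = 0"
    \<comment> \<open>A point of B with finitely many visits has a last one, and the orbit at that
      time lies in the never-returning part D.\<close>
    have "B - I \<subseteq> (\<Union>n. (T ^^ n) -` D \<inter> space M)"
    proof
      fix x assume x: "x \<in> B - I"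
      then have xs: "x \<in> space M" using sets.sets_into_space[OF assms(1)] by auto
      then obtain n where n: "\<And>k. k \<ge> n \<Longrightarrow> (T ^^ k) x \<notin> B" using x by (auto simp: I_def)
      define K where "K = {k. (T ^^ k) x \<in> B}"
      have "K \<subseteq> {..n}" unfolding K_def using n by (metis (mono_tags) atMost_iff mem_Collect_eq nat_le_linear subsetI)
      then have fin: "finite K" by (rule finite_subset) simp
      have "0 \<in> K" using x by (simp add: K_def)
      then have mK: "Max K \<in> K" using fin by (intro Max_in) auto
      have "(T ^^ k) ((T ^^ Max K) x) \<notin> B" if "k > 0" for k
      proof
        assume "(T ^^ k) ((T ^^ Max K) x) \<in> B"
        then have "k + Max K \<in> K" by (simp add: K_def funpow_add)
        with fin have "k + Max K \<le> Max K" by (rule Max_ge)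
        with that show False by simp
      qed
      with mK have "(T ^^ Max K) x \<in> D" by (auto simp: D_def K_def)
      with xs show "x \<in> (\<Union>n. (T ^^ n) -` D \<inter> space M)" by auto
    qed
    moreover have "(T ^^ n) -` D \<inter> space M \<in> null_sets M" for n
      using D emeasure_vimage_funpow[of D n] measurable_sets[OF measurable_funpow, of D n] by (auto simp: null_sets_def)
    ultimately have "B - I \<in> null_sets M"
      using null_sets_UN[of "\<lambda>n. (T ^^ n) -` D \<inter> space M" M] null_sets_subset[of _ M "B - I"] by auto
    moreover have "I \<in> null_sets M" using I0 I by auto
    ultimately have "(B - I) \<union> I \<in> null_sets M" by (rule null_sets.Un)
    then have "B \<in> null_sets M" by (rule null_sets_subset) auto
    with pos show ?thesis by auto
  qed
qed

text \<open>The ergodicity axiom speaks of strictly invariant sets. Instead of modifying B on a null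
  set, recurrence is used: if B is not null, almost every orbit meets B, and invariance carries
  membership back to the starting point.\<close>

lemma AE_invariant_trivial:
  assumes [measurable]: "B \<in> sets M" and inv: "AE x in M. T x \<in> B \<longleftrightarrow> x \<in> B"
  shows "(AE x in M. x \<in> B) \<or> (AE x in M. x \<notin> B)"
proof (cases "emeasure M B = 0")
  case True
  then have "B \<in> null_sets M" by auto
  then show ?thesis using AE_not_in by blast
next
  case False
  have "AE x in M. \<forall>n. (T ^^ Suc n) x \<in> B \<longleftrightarrow> (T ^^ n) x \<in> B"
    using AE_funpow[OF inv] by (simp add: AE_all_countable)
  then have "AE x in M. x \<in> B"
    using recurrence[OF assms(1) False]
  proof eventually_elim
    case (elim x)
    have "(T ^^ n) x \<in> B \<longleftrightarrow> x \<in> B" for n by (induction n) (use elim(1) in auto)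
    with elim(2) show ?case by blast
  qed
  then show ?thesis ..
qed

end

section \<open>Duality for the transfer operator and independence of the initial density\<close>

section \<open>The transfer operator and strong convergence\<close>

context conservative_ergodic_system
begin

lemma transfer_op_integrable: "integrable M f \<Longrightarrow> integrable M (transfer_op M T f)"
  using is_transfer_transfer_op unfolding is_transfer_def by blast

lemma transfer_op_set_integral:
  assumes "integrable M f" "B \<in> sets M"
  shows "(\<integral>x. indicator B x * transfer_op M T f x \<partial>M) = (\<integral>x. indicator B (T x) * f x \<partial>M)"
proof -
  have "(\<integral>x. indicator B x * transfer_op M T f x \<partial>M) = (\<integral>x. indicator (T -` B \<inter> space M) x * f x \<partial>M)"
    using is_transfer_transfer_op[OF assms(1)] assms(2)
    by (simp add: is_transfer_def set_lebesgue_integral_def)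
  also have "\<dots> = (\<integral>x. indicator B (T x) * f x \<partial>M)"
    by (intro Bochner_Integration.integral_cong) (auto simp: indicator_def)
  finally show ?thesis .
qed

lemma transfer_op_nonneg:
  assumes f: "integrable M f" "AE x in M. 0 \<le> f x"
  shows "AE x in M. 0 \<le> transfer_op M T f x"
proof -
  let ?t = "transfer_op M T f"
  note t = transfer_op_integrable[OF f(1)]
  note [measurable] = borel_measurable_integrable[OF t]
  define B where "B = {x \<in> space M. ?t x < 0}"
  have B[measurable]: "B \<in> sets M" unfolding B_def by measurable
  have i: "integrable M (\<lambda>x. indicator B x * - ?t x)"
    using t by (intro integrable_unit_interval_mult) (auto simp: indicator_def)
  have nn: "0 \<le> indicator B x * - ?t x" for x by (auto simp: B_def indicator_def)
  have "0 \<le> (\<integral>x. indicator B (T x) * f x \<partial>M)"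
    using f(2) by (intro integral_nonneg_AE) (auto elim: eventually_mono)
  then have "(\<integral>x. indicator B x * - ?t x \<partial>M) \<le> 0"
    using transfer_op_set_integral[OF f(1) B] by simp
  then have "(\<integral>x. indicator B x * - ?t x \<partial>M) = 0"
    using nn by (intro antisym integral_nonneg_AE) auto
  then have "AE x in M. indicator B x * - ?t x = 0"
    using i nn by (subst (asm) integral_nonneg_eq_0_iff_AE) auto
  then show ?thesis
    using AE_space by eventually_elim (auto simp: B_def indicator_def not_less split: if_splits)
qed

text \<open>The measure with density \<open>transfer_op M T f\<close> is the image under T of the
  measure with density f. Both sides integrate g against this one measure, so the identity holds for
  every measurable g.\<close>

lemma transfer_op_duality:
  assumes f: "integrable M f" "AE x in M. 0 \<le> f x"
    and g: "g \<in> borel_measurable M"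
  shows "(\<integral>x. g x * transfer_op M T f x \<partial>M) = (\<integral>x. g (T x) * f x \<partial>M)"
proof -
  let ?t = "transfer_op M T f"
  note t = transfer_op_integrable[OF f(1)]
  note [measurable] = borel_measurable_integrable[OF t] borel_measurable_integrable[OF f(1)] measurable_T g
  have "density M (\<lambda>x. ennreal (?t x)) = distr (density M (\<lambda>x. ennreal (f x))) M T"
  proof (rule measure_eqI)
    fix B assume "B \<in> sets (density M (\<lambda>x. ennreal (?t x)))"
    then have B[measurable]: "B \<in> sets M" by simp
    have "emeasure (density M (\<lambda>x. ennreal (?t x))) B = (\<integral>\<^sup>+x. ennreal (indicator B x * ?t x) \<partial>M)"
      by (subst emeasure_density) (auto intro!: nn_integral_cong simp: indicator_def)
    also have "\<dots> = ennreal (\<integral>x. indicator B x * ?t x \<partial>M)"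
      using transfer_op_nonneg[OF f] t
      by (intro nn_integral_eq_integral integrable_unit_interval_mult) (auto elim: eventually_mono simp: indicator_def)
    also have "\<dots> = ennreal (\<integral>x. indicator B (T x) * f x \<partial>M)"
      by (simp add: transfer_op_set_integral[OF f(1) B])
    also have "\<dots> = (\<integral>\<^sup>+x. ennreal (indicator B (T x) * f x) \<partial>M)"
      using f by (intro nn_integral_eq_integral[symmetric] integrable_unit_interval_mult)
        (auto elim: eventually_mono simp: indicator_def)
    also have "\<dots> = emeasure (distr (density M (\<lambda>x. ennreal (f x))) M T) B"
      by (subst emeasure_distr) (auto simp: emeasure_density intro!: nn_integral_cong simp: indicator_def)
    finally show "emeasure (density M (\<lambda>x. ennreal (?t x))) B = emeasure (distr (density M (\<lambda>x. ennreal (f x))) M T) B" .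
  qed simp
  then have "integral\<^sup>L (density M (\<lambda>x. ennreal (?t x))) g = integral\<^sup>L (distr (density M (\<lambda>x. ennreal (f x))) M T) g"
    by simp
  also have "integral\<^sup>L (density M (\<lambda>x. ennreal (?t x))) g = (\<integral>x. g x * ?t x \<partial>M)"
    using transfer_op_nonneg[OF f] by (subst integral_density) (auto simp: mult.commute)
  also have "integral\<^sup>L (distr (density M (\<lambda>x. ennreal (f x))) M T) g = (\<integral>x. g (T x) * f x \<partial>M)"
    using f(2) by (subst integral_distr) (auto simp: integral_density mult.commute)
  finally show ?thesis .
qed

lemma transfer_op_funpow:
  assumes f: "integrable M f" "AE x in M. 0 \<le> f x"
  shows "integrable M ((transfer_op M T ^^ n) f)" "AE x in M. 0 \<le> (transfer_op M T ^^ n) f x"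
  using f by (induction n) (simp_all add: transfer_op_integrable transfer_op_nonneg)

lemma transfer_op_funpow_duality:
  assumes f: "integrable M f" "AE x in M. 0 \<le> f x" and g: "g \<in> borel_measurable M"
  shows "(\<integral>x. g x * (transfer_op M T ^^ n) f x \<partial>M) = (\<integral>x. g ((T ^^ n) x) * f x \<partial>M)"
  using g
proof (induction n arbitrary: g)
  case (Suc n)
  note [measurable] = measurable_T Suc.prems
  have "(\<integral>x. g x * (transfer_op M T ^^ Suc n) f x \<partial>M) = (\<integral>x. g (T x) * (transfer_op M T ^^ n) f x \<partial>M)"
    using transfer_op_duality[OF transfer_op_funpow[OF f] Suc.prems] by simp
  also have "\<dots> = (\<integral>x. g (T ((T ^^ n) x)) * f x \<partial>M)"
    by (rule Suc.IH) measurable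
  finally show ?case by simp
qed simp

text \<open>
  A weak cluster point of an asymptotically invariant sequence is an invariant function, hence constant,
  so the limit of the integrals cannot depend on the density.
\<close>

lemma limsup_integral_le_if_asymptotically_invariant:
  fixes \<phi> :: "nat \<Rightarrow> 'a \<Rightarrow> real"
  assumes \<phi>: "\<And>n. \<phi> n \<in> borel_measurable M" "\<And>n x. 0 \<le> \<phi> n x" "\<And>n x. \<phi> n x \<le> 1"
    and inv: "\<And>h. \<lbrakk>integrable M h; \<And>x. 0 \<le> h x\<rbrakk> \<Longrightarrow>
      (\<lambda>n. (\<integral>x. \<phi> n (T x) * h x \<partial>M) - (\<integral>x. \<phi> n x * h x \<partial>M)) \<longlonglongrightarrow> 0"
    and f: "integrable M f" "AE x in M. 0 \<le> f x" "(\<integral>x. f x \<partial>M) = 1"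
    and lim: "(\<lambda>n. \<integral>x. \<phi> n x * f x \<partial>M) \<longlonglongrightarrow> u"
    and h: "integrable M h" "AE x in M. 0 \<le> h x" "(\<integral>x. h x \<partial>M) = 1"
    and "0 < \<epsilon>"
  shows "eventually (\<lambda>n. (\<integral>x. \<phi> n x * h x \<partial>M) < u + \<epsilon>) sequentially"
proof (rule ccontr)
  assume "\<not> ?thesis"
  from not_eventually_sequentiallyD[OF this] obtain r :: "nat \<Rightarrow> nat" where r: "strict_mono r"
    and ge: "\<And>n. u + \<epsilon> \<le> (\<integral>x. \<phi> (r n) x * h x \<partial>M)" by (auto simp: not_less)
  have r': "filterlim r at_top at_top" using r by (rule filterlim_subseq)
  obtain g :: "'a \<Rightarrow> real" where g: "g \<in> borel_measurable M" "\<And>x. 0 \<le> g x" "\<And>x. g x \<le> 1"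
    and cl: "\<And>h c. \<lbrakk>integrable M h; eventually (\<lambda>n. (\<integral>x. \<phi> (r n) x * h x \<partial>M) \<le> c) sequentially\<rbrakk>
        \<Longrightarrow> (\<integral>x. g x * h x \<partial>M) \<le> c"
    using weak_cluster_point[of "\<lambda>n. \<phi> (r n)"] \<phi> by blast
  note [measurable] = g(1) \<phi>(1) measurable_T
  have le_lim: "(\<integral>x. g x * k x \<partial>M) \<le> l"
    if k: "integrable M k" and "(\<lambda>n. \<integral>x. \<phi> n x * k x \<partial>M) \<longlonglongrightarrow> l" for k l
  proof (rule field_le_epsilon)
    fix e :: real assume "0 < e"
    have "(\<lambda>n. \<integral>x. \<phi> (r n) x * k x \<partial>M) \<longlonglongrightarrow> l" using that(2) r' by (rule filterlim_compose)
    then have "eventually (\<lambda>n. (\<integral>x. \<phi> (r n) x * k x \<partial>M) < l + e) sequentially"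
      using \<open>0 < e\<close> by (intro order_tendstoD(2)[of _ l]) auto
    then show "(\<integral>x. g x * k x \<partial>M) \<le> l + e"
      by (intro cl[OF k]) (auto elim: eventually_mono)
  qed
  have ints: "integrable M (\<lambda>x. q x * k x)"
    if "integrable M k" "q \<in> borel_measurable M" "\<And>x. 0 \<le> q x" "\<And>x. q x \<le> 1" for q k :: "'a \<Rightarrow> real"
    using integrable_unit_interval_mult that .
  \<comment> \<open>By duality, asymptotic invariance says that the integrals of \<phi> against ?t -
    k tend to 0. A cluster point only inherits upper bounds, so ?t - k and its negative are both
    tested.\<close>
  have g_inv: "(\<integral>x. g (T x) * k x \<partial>M) = (\<integral>x. g x * k x \<partial>M)" if k: "integrable M k" "\<And>x. 0 \<le> k x" for k
  proof -
    let ?t = "transfer_op M T k"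
    have k': "AE x in M. 0 \<le> k x" using k(2) by simp
    note t = transfer_op_integrable[OF k(1)]
    have "(\<integral>x. \<phi> n x * (?t x - k x) \<partial>M) = (\<integral>x. \<phi> n (T x) * k x \<partial>M) - (\<integral>x. \<phi> n x * k x \<partial>M)" for n
      using ints[OF t, of "\<phi> n"] ints[OF k(1), of "\<phi> n"] \<phi> transfer_op_duality[OF k(1) k', of "\<phi> n"]
      by (simp add: right_diff_distrib)
    then have z: "(\<lambda>n. \<integral>x. \<phi> n x * (?t x - k x) \<partial>M) \<longlonglongrightarrow> 0"
      using inv[OF k] by simp
    have "(\<integral>x. \<phi> n x * (k x - ?t x) \<partial>M) = - (\<integral>x. \<phi> n x * (?t x - k x) \<partial>M)" for n
      by (subst integral_minus[symmetric]) (auto intro!: Bochner_Integration.integral_cong simp: algebra_simps)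
    then have z': "(\<lambda>n. \<integral>x. \<phi> n x * (k x - ?t x) \<partial>M) \<longlonglongrightarrow> 0"
      using tendsto_minus[OF z] by simp
    have "(\<integral>x. g x * (?t x - k x) \<partial>M) \<le> 0" "(\<integral>x. g x * (k x - ?t x) \<partial>M) \<le> 0"
      using le_lim[OF _ z] le_lim[OF _ z'] t k(1) by auto
    then have "(\<integral>x. g x * ?t x \<partial>M) = (\<integral>x. g x * k x \<partial>M)"
      using ints[OF t g] ints[OF k(1) g] by (simp add: right_diff_distrib)
    then show ?thesis using transfer_op_duality[OF k(1) k' g(1)] by simp
  qed
  have "AE x in M. g (T x) \<le> g x" "AE x in M. g x \<le> g (T x)"
    using g g_inv by (auto intro!: AE_le_if_integral_mult_le)
  \<comment> \<open>The level u + \<epsilon>/2 separates the limit u under f from the assumed bound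
    u + \<epsilon> under h. By ergodicity g lies almost everywhere on one side of it, and either
    side contradicts one of the two.\<close>
  then have "AE x in M. T x \<in> {x \<in> space M. u + \<epsilon> / 2 < g x} \<longleftrightarrow> x \<in> {x \<in> space M. u + \<epsilon> / 2 < g x}"
    using AE_space by eventually_elim (use measurable_space[OF measurable_T] in auto)
  then have "(AE x in M. x \<in> {x \<in> space M. u + \<epsilon> / 2 < g x}) \<or> (AE x in M. x \<notin> {x \<in> space M. u + \<epsilon> / 2 < g x})"
    by (intro AE_invariant_trivial) measurable
  then show False
  proof
    assume "AE x in M. x \<in> {x \<in> space M. u + \<epsilon> / 2 < g x}"
    then have "AE x in M. (u + \<epsilon> / 2) * f x \<le> g x * f x"
      using f(2) by eventually_elim (auto intro: mult_right_mono)
    then have "(\<integral>x. (u + \<epsilon> / 2) * f x \<partial>M) \<le> (\<integral>x. g x * f x \<partial>M)"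
      using f(1) ints[OF f(1) g] by (intro integral_mono_AE) auto
    also have "\<dots> \<le> u" by (rule le_lim[OF f(1) lim])
    finally show False using f(3) \<open>0 < \<epsilon>\<close> by simp
  next
    assume "AE x in M. x \<notin> {x \<in> space M. u + \<epsilon> / 2 < g x}"
    then have "AE x in M. g x * h x \<le> (u + \<epsilon> / 2) * h x"
      using h(2) AE_space by eventually_elim (auto intro: mult_right_mono simp: not_less)
    then have "(\<integral>x. g x * h x \<partial>M) \<le> (\<integral>x. (u + \<epsilon> / 2) * h x \<partial>M)"
      using h(1) ints[OF h(1) g] by (intro integral_mono_AE) auto
    also have "\<dots> = u + \<epsilon> / 2" using h(3) by simp
    finally have "(\<integral>x. g x * h x \<partial>M) \<le> u + \<epsilon> / 2" .
    \<comment> \<open>The lower bound for the integral against h is inherited as an upper bound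
      against -h.\<close>
    moreover have "(\<integral>x. g x * - h x \<partial>M) \<le> - (u + \<epsilon>)"
    proof (rule cl)
      show "eventually (\<lambda>n. (\<integral>x. \<phi> (r n) x * - h x \<partial>M) \<le> - (u + \<epsilon>)) sequentially"
        using ge by (simp only: mult_minus_right integral_minus neg_le_iff_le) simp
    qed (use h(1) in simp)
    ultimately show False using \<open>0 < \<epsilon>\<close> by simp
  qed
qed

text \<open>The one-sided estimate is applied to \<phi> for the upper bound and to 1 - \<phi> for
  the lower bound; passing to the complement only changes the sign in the invariance
  condition.\<close>

proposition strong_convergence_of_integrals:
  fixes \<phi> :: "nat \<Rightarrow> 'a \<Rightarrow> real"
  assumes \<phi>: "\<And>n. \<phi> n \<in> borel_measurable M" "\<And>n x. 0 \<le> \<phi> n x" "\<And>n x. \<phi> n x \<le> 1"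
    and inv: "\<And>h. \<lbrakk>integrable M h; \<And>x. 0 \<le> h x\<rbrakk> \<Longrightarrow>
      (\<lambda>n. (\<integral>x. \<phi> n (T x) * h x \<partial>M) - (\<integral>x. \<phi> n x * h x \<partial>M)) \<longlonglongrightarrow> 0"
    and f: "integrable M f" "AE x in M. 0 \<le> f x" "(\<integral>x. f x \<partial>M) = 1"
    and lim: "(\<lambda>n. \<integral>x. \<phi> n x * f x \<partial>M) \<longlonglongrightarrow> u"
    and h: "integrable M h" "AE x in M. 0 \<le> h x" "(\<integral>x. h x \<partial>M) = 1"
  shows "(\<lambda>n. \<integral>x. \<phi> n x * h x \<partial>M) \<longlonglongrightarrow> u"
proof -
  note [measurable] = \<phi>(1) measurable_T
  have i: "integrable M (\<lambda>x. \<phi> n x * k x)" if "integrable M k" for k n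
    using integrable_unit_interval_mult[OF that] \<phi> by blast
  have iT: "integrable M (\<lambda>x. \<phi> n (T x) * k x)" if "integrable M k" for k n
    using that \<phi> by (intro integrable_unit_interval_mult) auto
  have compl: "(\<integral>x. (1 - \<phi> n x) * k x \<partial>M) = (\<integral>x. k x \<partial>M) - (\<integral>x. \<phi> n x * k x \<partial>M)" if "integrable M k" for k n
    using i[OF that] that by (simp add: left_diff_distrib)
  have complT: "(\<integral>x. (1 - \<phi> n (T x)) * k x \<partial>M) = (\<integral>x. k x \<partial>M) - (\<integral>x. \<phi> n (T x) * k x \<partial>M)" if "integrable M k" for k n
    using iT[OF that] that by (simp add: left_diff_distrib)
  show ?thesis
  proof (rule order_tendstoI)
    fix a assume "u < a"
    then show "eventually (\<lambda>n. (\<integral>x. \<phi> n x * h x \<partial>M) < a) sequentially"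
      using limsup_integral_le_if_asymptotically_invariant[OF \<phi> inv f lim h, of "a - u"] by simp
  next
    fix a assume "a < u"
    have "eventually (\<lambda>n. (\<integral>x. (1 - \<phi> n x) * h x \<partial>M) < (1 - u) + (u - a)) sequentially"
    proof (rule limsup_integral_le_if_asymptotically_invariant[OF _ _ _ _ f _ h])
      show "(\<lambda>n. (\<integral>x. (1 - \<phi> n (T x)) * k x \<partial>M) - (\<integral>x. (1 - \<phi> n x) * k x \<partial>M)) \<longlonglongrightarrow> 0"
        if k: "integrable M k" "\<And>x. 0 \<le> k x" for k
        using tendsto_minus[OF inv[OF k]] by (simp add: compl complT k(1))
      show "(\<lambda>n. \<integral>x. (1 - \<phi> n x) * f x \<partial>M) \<longlonglongrightarrow> 1 - u"
        using tendsto_diff[OF tendsto_const lim, of 1] by (simp add: compl f)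
    qed (use \<phi> \<open>a < u\<close> in auto)
    then show "eventually (\<lambda>n. a < (\<integral>x. \<phi> n x * h x \<partial>M)) sequentially"
      by (simp add: compl h)
  qed
qed

text \<open>Convergence under all shifts takes the place of asymptotic invariance. A cluster point g
  has integral 0 against every iterate of f, so g vanishes along almost every orbit starting where f
  > 0. If g were positive on a non-null set, recurrence would lead such orbits into it.\<close>

proposition strong_null_convergence_of_integrals:
  fixes \<phi> :: "nat \<Rightarrow> 'a \<Rightarrow> real"
  assumes \<phi>: "\<And>n. \<phi> n \<in> borel_measurable M" "\<And>n x. 0 \<le> \<phi> n x" "\<And>n x. \<phi> n x \<le> 1"
    and f: "integrable M f" "AE x in M. 0 \<le> f x" "(\<integral>x. f x \<partial>M) = 1"
    and lim: "\<And>k. (\<lambda>n. \<integral>x. \<phi> n ((T ^^ k) x) * f x \<partial>M) \<longlonglongrightarrow> 0"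
    and h: "integrable M h" "AE x in M. 0 \<le> h x"
  shows "(\<lambda>n. \<integral>x. \<phi> n x * h x \<partial>M) \<longlonglongrightarrow> 0"
proof (rule order_tendstoI)
  fix a :: real assume "a < 0"
  moreover have "0 \<le> (\<integral>x. \<phi> n x * h x \<partial>M)" for n
    using \<phi> h(2) by (intro integral_nonneg_AE) (auto elim: eventually_mono)
  ultimately show "eventually (\<lambda>n. a < (\<integral>x. \<phi> n x * h x \<partial>M)) sequentially"
    by (auto intro: always_eventually less_le_trans)
next
  fix a :: real assume "0 < a"
  show "eventually (\<lambda>n. (\<integral>x. \<phi> n x * h x \<partial>M) < a) sequentially"
  proof (rule ccontr)
    assume "\<not> ?thesis"
    from not_eventually_sequentiallyD[OF this] obtain r :: "nat \<Rightarrow> nat" where r: "strict_mono r"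
      and ge: "\<And>n. a \<le> (\<integral>x. \<phi> (r n) x * h x \<partial>M)" by (auto simp: not_less)
    have r': "filterlim r at_top at_top" using r by (rule filterlim_subseq)
    obtain g :: "'a \<Rightarrow> real" where g: "g \<in> borel_measurable M" "\<And>x. 0 \<le> g x" "\<And>x. g x \<le> 1"
      and cl: "\<And>h c. \<lbrakk>integrable M h; eventually (\<lambda>n. (\<integral>x. \<phi> (r n) x * h x \<partial>M) \<le> c) sequentially\<rbrakk>
          \<Longrightarrow> (\<integral>x. g x * h x \<partial>M) \<le> c"
      using weak_cluster_point[of "\<lambda>n. \<phi> (r n)"] \<phi> by blast
    note [measurable] = g(1)
    have "AE x in M. g ((T ^^ k) x) * f x = 0" for k
    proof -
      have "(\<integral>x. g x * (transfer_op M T ^^ k) f x \<partial>M) \<le> 0"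
      proof (rule field_le_epsilon)
        fix e :: real assume "0 < e"
        have "(\<lambda>n. \<integral>x. \<phi> (r n) ((T ^^ k) x) * f x \<partial>M) \<longlonglongrightarrow> 0" using lim r' by (rule filterlim_compose)
        then have "eventually (\<lambda>n. (\<integral>x. \<phi> (r n) ((T ^^ k) x) * f x \<partial>M) < 0 + e) sequentially"
          using \<open>0 < e\<close> by (intro order_tendstoD(2)[of _ 0]) auto
        then show "(\<integral>x. g x * (transfer_op M T ^^ k) f x \<partial>M) \<le> 0 + e"
          by (intro cl transfer_op_funpow(1)[OF f(1,2)])
            (auto simp: transfer_op_funpow_duality[OF f(1,2) \<phi>(1)] elim: eventually_mono)
      qed
      then have le: "(\<integral>x. g ((T ^^ k) x) * f x \<partial>M) \<le> 0"
        by (simp add: transfer_op_funpow_duality[OF f(1,2) g(1)])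
      have nn: "AE x in M. 0 \<le> g ((T ^^ k) x) * f x"
        using f(2) by eventually_elim (use g(2) in auto)
      have i: "integrable M (\<lambda>x. g ((T ^^ k) x) * f x)"
        using f(1) g by (intro integrable_unit_interval_mult) auto
      from le nn have "(\<integral>x. g ((T ^^ k) x) * f x \<partial>M) = 0"
        by (intro antisym integral_nonneg_AE)
      then show ?thesis
        using integral_nonneg_eq_0_iff_AE[OF i nn] by simp
    qed
    then have z: "AE x in M. \<forall>k. g ((T ^^ k) x) * f x = 0" unfolding AE_all_countable ..
    define B where "B = {x \<in> space M. 0 < g x}"
    have B[measurable]: "B \<in> sets M" unfolding B_def by measurable
    have "emeasure M B = 0"
    proof (rule ccontr)
      assume "emeasure M B \<noteq> 0"
      from recurrence[OF B this] z have "AE x in M. f x = 0"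
        by eventually_elim (auto simp: B_def)
      then have "(\<integral>x. f x \<partial>M) = (\<integral>x. 0 \<partial>M)"
        using f(1) by (intro integral_cong_AE) auto
      with f(3) show False by simp
    qed
    then have "B \<in> null_sets M" by auto
    then have "AE x in M. x \<notin> B" by (rule AE_not_in)
    then have "AE x in M. g x * h x = 0"
      using AE_space by eventually_elim (use g(2) in \<open>auto simp: B_def not_less intro: antisym\<close>)
    then have "(\<integral>x. g x * h x \<partial>M) = (\<integral>x. 0 \<partial>M)"
      using h(1) by (intro integral_cong_AE) auto
    moreover have "(\<integral>x. g x * - h x \<partial>M) \<le> - a"
      by (rule cl) (use h(1) ge in auto)
    ultimately show False using \<open>0 < a\<close> by simp
  qed
qed

end

section \<open>Decomposition by the last visit and expected numbers of visits to subsets of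
  A\<close>

section \<open>Last visits and uniform sets\<close>

definition no_visit :: "'a measure \<Rightarrow> ('a \<Rightarrow> 'a) \<Rightarrow> 'a set \<Rightarrow> nat \<Rightarrow> nat \<Rightarrow> 'a set" where
  "no_visit M T A m n = {x \<in> space M. \<forall>k. m < k \<and> k \<le> n \<longrightarrow> (T ^^ k) x \<notin> A}"

text \<open>This is the part of A where the first return time to A exceeds n.\<close>

definition excursion_set :: "'a measure \<Rightarrow> ('a \<Rightarrow> 'a) \<Rightarrow> 'a set \<Rightarrow> nat \<Rightarrow> 'a set" where
  "excursion_set M T A n = A \<inter> no_visit M T A 0 n"

text \<open>The default value 0 outside \<open>hit_set M T A n\<close> is consistent with this: a
  point that never visits A up to n avoids A in the window (m, n] for every m.\<close>

lemma last_visit_le_iff: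
  assumes "x \<in> space M"
  shows "last_visit M T A n x \<le> m \<longleftrightarrow> x \<in> no_visit M T A m n"
proof (cases "x \<in> hit_set M T A n")
  case True
  let ?S = "{k. k \<le> n \<and> (T ^^ k) x \<in> A}"
  have "?S \<noteq> {}" "finite ?S" using True by (auto simp: hit_set_def)
  then have "Max ?S \<le> m \<longleftrightarrow> (\<forall>k\<in>?S. k \<le> m)" by simp
  also have "\<dots> \<longleftrightarrow> x \<in> no_visit M T A m n"
    using assms by (auto simp: no_visit_def not_less[symmetric])
  finally show ?thesis using True by (simp add: last_visit_def)
next
  case False
  then show ?thesis using assms by (auto simp: last_visit_def hit_set_def no_visit_def)
qed

lemma (in sigma_finite_measure) prob_density_properties:
  assumes f: "f \<in> borel_measurable M" "AE x in M. 0 \<le> f x"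
    and prob: "prob_space (density M (\<lambda>x. ennreal (f x)))"
  shows "integrable M f" "(\<integral>x. f x \<partial>M) = 1"
    and "B \<in> sets M \<Longrightarrow> measure (density M (\<lambda>x. ennreal (f x))) B = (\<integral>x. indicator B x * f x \<partial>M)"
proof -
  note [measurable] = f(1)
  have "(\<integral>\<^sup>+x. ennreal (f x) \<partial>M) = 1"
    using prob_space.emeasure_space_1[OF prob] by (simp add: emeasure_density cong: nn_integral_cong)
  then show i: "integrable M f" and "(\<integral>x. f x \<partial>M) = 1"
    using f by (auto intro!: integrableI_nonneg simp: integral_eq_nn_integral)
  assume B[measurable]: "B \<in> sets M"
  have "emeasure (density M (\<lambda>x. ennreal (f x))) B = (\<integral>\<^sup>+x. ennreal (indicator B x * f x) \<partial>M)"
    by (subst emeasure_density) (auto intro!: nn_integral_cong simp: indicator_def)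
  also have "\<dots> = ennreal (\<integral>x. indicator B x * f x \<partial>M)"
    using f i by (intro nn_integral_eq_integral integrable_unit_interval_mult)
      (auto elim: eventually_mono simp: indicator_def)
  finally have "emeasure (density M (\<lambda>x. ennreal (f x))) B = ennreal (\<integral>x. indicator B x * f x \<partial>M)" .
  moreover have "0 \<le> (\<integral>x. indicator B x * f x \<partial>M)"
    using f(2) by (intro integral_nonneg_AE) (auto elim: eventually_mono)
  ultimately show "measure (density M (\<lambda>x. ennreal (f x))) B = (\<integral>x. indicator B x * f x \<partial>M)"
    by (simp add: measure_def)
qed

lemma (in sigma_finite_measure) ac_prob_density_exists:
  assumes "\<nu> \<in> ac_prob M"
  obtains h :: "'a \<Rightarrow> real" where "h \<in> borel_measurable M" "\<forall>x. 0 \<le> h x" "\<nu> = density M (\<lambda>x. ennreal (h x))"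
proof -
  have \<nu>: "prob_space \<nu>" "sets \<nu> = sets M" "absolutely_continuous M \<nu>"
    using assms by (auto simp: ac_prob_def)
  then interpret \<nu>: prob_space \<nu> by simp
  obtain D where D: "D \<in> borel_measurable M" "AE x in M. RN_deriv M \<nu> x = ennreal (D x)" "\<And>x. 0 \<le> D x"
    using real_RN_deriv[OF \<nu>.finite_measure_axioms \<nu>(3,2)] by blast
  have "\<nu> = density M (RN_deriv M \<nu>)" using density_RN_deriv[OF \<nu>(3,2)] ..
  also have "\<dots> = density M (\<lambda>x. ennreal (D x))"
    using D by (intro density_cong) auto
  finally show ?thesis using that D by blast
qed

context conservative_ergodic_system
begin

context
  fixes A assumes A [measurable]: "A \<in> sets M"
begin

lemma no_visit_sets [measurable]: "no_visit M T A m n \<in> sets M"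
  unfolding no_visit_def by measurable

lemma hit_set_sets [measurable]: "hit_set M T A n \<in> sets M"
  unfolding hit_set_def by measurable

lemma last_visit_measurable [measurable]: "last_visit M T A n \<in> measurable M (count_space UNIV)"
  unfolding last_visit_def[abs_def] using hit_set_sets by measurable

lemma excursion_set_sets [measurable]: "excursion_set M T A n \<in> sets M"
  unfolding excursion_set_def by measurable

lemma excursion_set_subset: "excursion_set M T A n \<subseteq> A"
  by (auto simp: excursion_set_def)

lemma excursion_set_antimono: "m \<le> n \<Longrightarrow> excursion_set M T A n \<subseteq> excursion_set M T A m"
  by (auto simp: excursion_set_def no_visit_def)

lemma vimage_no_visit:
  "x \<in> space M \<Longrightarrow> T x \<in> no_visit M T A m n \<longleftrightarrow> x \<in> no_visit M T A (Suc m) (Suc n)"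
proof -
  assume x: "x \<in> space M"
  have "(\<forall>k. m < k \<and> k \<le> n \<longrightarrow> (T ^^ Suc k) x \<notin> A) \<longleftrightarrow> (\<forall>k. Suc m < k \<and> k \<le> Suc n \<longrightarrow> (T ^^ k) x \<notin> A)"
    by (metis Suc_le_mono Suc_less_eq Suc_lessE)
  then show ?thesis
    using x measurable_space[OF measurable_T x] by (simp add: no_visit_def funpow_swap1)
qed

lemma funpow_in_excursion_set_iff:
  assumes "x \<in> space M" "k \<le> n"
  shows "(T ^^ k) x \<in> excursion_set M T A (n - k) \<longleftrightarrow> (T ^^ k) x \<in> A \<and> x \<in> no_visit M T A k n"
proof -
  have "(\<forall>j. 0 < j \<and> j \<le> n - k \<longrightarrow> (T ^^ j) ((T ^^ k) x) \<notin> A) \<longleftrightarrow> (\<forall>i. k < i \<and> i \<le> n \<longrightarrow> (T ^^ i) x \<notin> A)"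
  proof (intro iffI allI impI)
    fix i assume "\<forall>j. 0 < j \<and> j \<le> n - k \<longrightarrow> (T ^^ j) ((T ^^ k) x) \<notin> A" "k < i \<and> i \<le> n"
    then show "(T ^^ i) x \<notin> A" using funpow_add[of "i - k" k T] by (auto dest!: spec[of _ "i - k"])
  next
    fix j assume "\<forall>i. k < i \<and> i \<le> n \<longrightarrow> (T ^^ i) x \<notin> A" "0 < j \<and> j \<le> n - k"
    then show "(T ^^ j) ((T ^^ k) x) \<notin> A" using funpow_add[of j k T] assms by (auto dest!: spec[of _ "j + k"])
  qed
  then show ?thesis
    using assms funpow_in_space[of x k] by (auto simp: excursion_set_def no_visit_def)
qed

lemma last_visit_decomposition:
  assumes "m \<le> n"
  shows "hit_set M T A n \<inter> no_visit M T A m n = (\<Union>k\<le>m. (T ^^ k) -` excursion_set M T A (n - k) \<inter> space M)"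
proof (intro set_eqI iffI)
  fix x assume x: "x \<in> hit_set M T A n \<inter> no_visit M T A m n"
  then have xs: "x \<in> space M" by (auto simp: no_visit_def)
  define k where "k = Max {k. k \<le> n \<and> (T ^^ k) x \<in> A}"
  have k_lv: "k = last_visit M T A n x" using x by (simp add: k_def last_visit_def)
  have "k \<in> {k. k \<le> n \<and> (T ^^ k) x \<in> A}"
    unfolding k_def using x by (intro Max_in) (auto simp: hit_set_def)
  moreover have "k \<le> m" using x xs by (simp add: k_lv last_visit_le_iff)
  moreover have "x \<in> no_visit M T A k n" using xs by (simp flip: last_visit_le_iff add: k_lv)
  ultimately show "x \<in> (\<Union>k\<le>m. (T ^^ k) -` excursion_set M T A (n - k) \<inter> space M)"
    using xs assms by (auto simp: funpow_in_excursion_set_iff intro!: bexI[of _ k])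
next
  fix x assume "x \<in> (\<Union>k\<le>m. (T ^^ k) -` excursion_set M T A (n - k) \<inter> space M)"
  then obtain k where "k \<le> m" "x \<in> space M" "(T ^^ k) x \<in> A" "x \<in> no_visit M T A k n"
    using assms by (auto simp: funpow_in_excursion_set_iff)
  then show "x \<in> hit_set M T A n \<inter> no_visit M T A m n"
    using assms by (auto simp: hit_set_def no_visit_def intro!: exI[of _ k])
qed

lemma last_visit_disjoint:
  assumes "m \<le> n"
  shows "disjoint_family_on (\<lambda>k. (T ^^ k) -` excursion_set M T A (n - k) \<inter> space M) {..m}"
  unfolding disjoint_family_on_def
proof (intro ballI impI equals0I)
  fix i j x assume ij: "i \<in> {..m}" "j \<in> {..m}" "i \<noteq> j"
    and x: "x \<in> (T ^^ i) -` excursion_set M T A (n - i) \<inter> space M \<inter> ((T ^^ j) -` excursion_set M T A (n - j) \<inter> space M)"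
  have "i \<le> n" "j \<le> n" using ij assms by auto
  moreover have "(T ^^ k) x \<in> A \<and> x \<in> no_visit M T A k n" if "k = i \<or> k = j" for k
    using x \<open>i \<le> n\<close> \<open>j \<le> n\<close> that funpow_in_excursion_set_iff[of x k n] by auto
  moreover have False if "p < q" "q \<le> n" "x \<in> no_visit M T A p n" "(T ^^ q) x \<in> A" for p q
    using that by (simp add: no_visit_def)
  ultimately show False
    using ij(3) by (metis linorder_neqE_nat)
qed

text \<open>The measure N is kept general because the decomposition is used twice: with M it yields
  the wandering rate, and with the probability measure of density f the law of the last
  visit.\<close>

lemma emeasure_last_visit:
  assumes "m \<le> n" "sets N = sets M"
  shows "emeasure N (hit_set M T A n \<inter> no_visit M T A m n) =
    (\<Sum>k\<le>m. emeasure N ((T ^^ k) -` excursion_set M T A (n - k) \<inter> space M))"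
  unfolding last_visit_decomposition[OF assms(1)]
proof (rule sum_emeasure[symmetric, OF _ last_visit_disjoint[OF assms(1)]])
  have "(T ^^ k) -` excursion_set M T A (n - k) \<inter> space M \<in> sets M" for k
    by measurable
  then show "(\<lambda>k. (T ^^ k) -` excursion_set M T A (n - k) \<inter> space M) ` {..m} \<subseteq> sets N"
    using assms(2) by blast
qed simp

lemma hit_set_Int_no_visit: "hit_set M T A n \<inter> no_visit M T A n n = hit_set M T A n"
  by (auto simp: hit_set_def no_visit_def)

lemma hit_set_Un_no_visit: "(space M - hit_set M T A n) \<union> (hit_set M T A n \<inter> no_visit M T A m n) = no_visit M T A m n"
  by (auto simp: hit_set_def no_visit_def)

lemma wandering_rate_eq_sum:
  assumes fin: "emeasure M A < \<infinity>"
  shows "wandering_rate M T A n = (\<Sum>j\<le>n. measure M (excursion_set M T A j))"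
proof -
  have e: "emeasure M (excursion_set M T A j) = ennreal (measure M (excursion_set M T A j))" for j
    using emeasure_mono[OF excursion_set_subset[of j] A] fin
    by (intro emeasure_eq_ennreal_measure) (auto simp: top_unique)
  have "emeasure M (hit_set M T A n) = (\<Sum>k\<le>n. emeasure M (excursion_set M T A (n - k)))"
    using emeasure_last_visit[of n n M] by (simp add: hit_set_Int_no_visit emeasure_vimage_funpow)
  also have "\<dots> = (\<Sum>j\<le>n. emeasure M (excursion_set M T A j))"
    using sum.nat_diff_reindex[of "\<lambda>j. emeasure M (excursion_set M T A j)" "Suc n"]
    by (simp only: lessThan_Suc_atMost) simp
  also have "\<dots> = ennreal (\<Sum>j\<le>n. measure M (excursion_set M T A j))"
    by (simp add: e)
  finally show ?thesis
    unfolding wandering_rate_def by (simp add: measure_def sum_nonneg)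
qed

text \<open>The sets decrease to the points of A that never return, a null set by
  conservativity.\<close>

lemma measure_excursion_set_tendsto_0:
  assumes fin: "emeasure M A < \<infinity>"
  shows "(\<lambda>n. measure M (excursion_set M T A n)) \<longlonglongrightarrow> 0"
proof -
  have "emeasure M (excursion_set M T A i) \<noteq> \<infinity>" for i
    using emeasure_mono[OF excursion_set_subset[of i] A] fin by (auto simp: top_unique)
  then have "(\<lambda>n. measure M (excursion_set M T A n)) \<longlonglongrightarrow> measure M (\<Inter>n. excursion_set M T A n)"
    by (intro Lim_measure_decseq) (auto simp: decseq_def excursion_set_antimono)
  moreover have "(\<Inter>n. excursion_set M T A n) = {x \<in> A. \<forall>k>0. (T ^^ k) x \<notin> A}"
    using sets.sets_into_space[OF A] by (auto simp: excursion_set_def no_visit_def)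
  moreover have "measure M {x \<in> A. \<forall>k>0. (T ^^ k) x \<notin> A} = 0"
    using never_returning_null[OF A] by (auto simp: measure_def)
  ultimately show ?thesis by simp
qed

end

text \<open>Integrating the sum of the iterates of f over B gives the expected number of visits to
  B. The quantifier over B stands inside \<open>eventually\<close>, so that sets depending on n are
  covered.\<close>

lemma uniform_set_for_visits:
  assumes "uniform_set_for M T A f"
  defines "\<nu> \<equiv> density M (\<lambda>x. ennreal (f x))"
  obtains a :: "nat \<Rightarrow> real" where "\<And>n. 0 < a n"
    "\<And>\<epsilon>. 0 < \<epsilon> \<Longrightarrow> eventually (\<lambda>n. \<forall>B\<in>sets M. B \<subseteq> A \<longrightarrow>
       \<bar>(\<Sum>k\<le>n. measure \<nu> ((T ^^ k) -` B \<inter> space M)) - a n * measure M B\<bar> \<le> \<epsilon> * (a n * measure M B)) sequentially"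
proof -
  have A: "A \<in> sets M" "emeasure M A < \<infinity>" and f: "f \<in> borel_measurable M" "AE x in M. 0 \<le> f x"
    and prob: "prob_space \<nu>"
    using assms(1) by (auto simp: uniform_set_for_def ac_prob_density_def ac_prob_def \<nu>_def)
  note fp = prob_density_properties[OF f prob[unfolded \<nu>_def], folded \<nu>_def]
  define S where "S n x = (\<Sum>k<n. (transfer_op M T ^^ k) f x)" for n x
  obtain a :: "nat \<Rightarrow> real" and N where a: "\<And>n. 0 < a n" and N: "N \<in> null_sets M"
    and unif: "uniform_limit (A - N) (\<lambda>n x. 1 / a n * S n x) (\<lambda>_. 1) sequentially"
    using assms(1) unfolding uniform_set_for_def S_def by blast
  have S_int: "integrable M (S n)" for n
    unfolding S_def using transfer_op_funpow(1)[OF fp(1) f(2)] by auto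
  have visits: "(\<Sum>k\<le>n. measure \<nu> ((T ^^ k) -` B \<inter> space M)) = (\<integral>x. indicator B x * S (Suc n) x \<partial>M)"
    if B[measurable]: "B \<in> sets M" for B n
  proof -
    have "measure \<nu> ((T ^^ k) -` B \<inter> space M) = (\<integral>x. indicator B x * (transfer_op M T ^^ k) f x \<partial>M)" for k
    proof -
      have "measure \<nu> ((T ^^ k) -` B \<inter> space M) = (\<integral>x. indicator ((T ^^ k) -` B \<inter> space M) x * f x \<partial>M)"
        by (rule fp(3)) measurable
      also have "\<dots> = (\<integral>x. indicator B ((T ^^ k) x) * f x \<partial>M)"
        by (intro Bochner_Integration.integral_cong) (auto simp: indicator_def)
      also have "\<dots> = (\<integral>x. indicator B x * (transfer_op M T ^^ k) f x \<partial>M)"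
        by (rule transfer_op_funpow_duality[OF fp(1) f(2), symmetric]) simp
      finally show ?thesis .
    qed
    then have "(\<Sum>k\<le>n. measure \<nu> ((T ^^ k) -` B \<inter> space M)) = (\<Sum>k\<le>n. \<integral>x. indicator B x * (transfer_op M T ^^ k) f x \<partial>M)"
      by simp
    also have "\<dots> = (\<integral>x. (\<Sum>k\<le>n. indicator B x * (transfer_op M T ^^ k) f x) \<partial>M)"
      using transfer_op_funpow(1)[OF fp(1) f(2)]
      by (intro Bochner_Integration.integral_sum[symmetric] integrable_unit_interval_mult) (auto simp: indicator_def)
    finally show ?thesis by (simp add: S_def lessThan_Suc_atMost sum_distrib_left)
  qed
  have bound: "\<bar>(\<Sum>k\<le>n. measure \<nu> ((T ^^ k) -` B \<inter> space M)) - a (Suc n) * measure M B\<bar> \<le> \<epsilon> * (a (Suc n) * measure M B)"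
    if elim: "\<forall>x\<in>A - N. dist (1 / a (Suc n) * S (Suc n) x) 1 < \<epsilon>"
      and B[measurable]: "B \<in> sets M" and "B \<subseteq> A" for n B \<epsilon>
  proof -
    let ?a = "a (Suc n)"
    have fin: "emeasure M B < \<infinity>" using emeasure_mono[OF \<open>B \<subseteq> A\<close> A(1)] A(2) by simp
    have i: "integrable M (\<lambda>x. indicator B x * S (Suc n) x)"
      using S_int by (intro integrable_unit_interval_mult) (auto simp: indicator_def)
    have ia: "integrable M (\<lambda>x. indicator B x * c)" for c :: real
      using fin by (intro integrable_mult_left) simp
    have eq: "(\<Sum>k\<le>n. measure \<nu> ((T ^^ k) -` B \<inter> space M)) - ?a * measure M B = (\<integral>x. indicator B x * S (Suc n) x - indicator B x * ?a \<partial>M)"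
      using i ia[of ?a] fin by (simp add: visits mult.commute)
    have "\<bar>\<integral>x. indicator B x * S (Suc n) x - indicator B x * ?a \<partial>M\<bar> \<le> (\<integral>x. \<bar>indicator B x * S (Suc n) x - indicator B x * ?a\<bar> \<partial>M)"
      using integral_norm_bound[of M "\<lambda>x. indicator B x * S (Suc n) x - indicator B x * ?a"] by simp
    also have "\<dots> \<le> (\<integral>x. indicator B x * (\<epsilon> * ?a) \<partial>M)"
    proof (rule integral_mono_AE)
      show "integrable M (\<lambda>x. \<bar>indicator B x * S (Suc n) x - indicator B x * ?a\<bar>)"
        by (intro integrable_abs Bochner_Integration.integrable_diff i ia)
      show "AE x in M. \<bar>indicator B x * S (Suc n) x - indicator B x * ?a\<bar> \<le> indicator B x * (\<epsilon> * ?a)"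
        using AE_not_in[OF N]
      proof eventually_elim
        fix x assume "x \<notin> N"
        show "\<bar>indicator B x * S (Suc n) x - indicator B x * ?a\<bar> \<le> indicator B x * (\<epsilon> * ?a)"
        proof (cases "x \<in> B")
          case True
          with \<open>x \<notin> N\<close> \<open>B \<subseteq> A\<close> have "x \<in> A - N" by blast
          from elim[rule_format, OF this] have "\<bar>S (Suc n) x / ?a - 1\<bar> < \<epsilon>"
            by (simp add: dist_real_def)
          then have "\<bar>S (Suc n) x / ?a - 1\<bar> * ?a \<le> \<epsilon> * ?a"
            using a[of "Suc n"] by (intro mult_right_mono) auto
          also have "\<bar>S (Suc n) x / ?a - 1\<bar> * ?a = \<bar>(S (Suc n) x / ?a - 1) * ?a\<bar>"
            using a[of "Suc n"] by (simp add: abs_mult)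
          also have "(S (Suc n) x / ?a - 1) * ?a = S (Suc n) x - ?a"
            using a[of "Suc n"] by (simp add: left_diff_distrib)
          finally show ?thesis using True by simp
        qed simp
      qed
    qed (rule ia)
    also have "\<dots> = \<epsilon> * (?a * measure M B)" using fin by simp
  finally show ?thesis unfolding eq .
  qed
  have ev: "eventually (\<lambda>n. \<forall>B\<in>sets M. B \<subseteq> A \<longrightarrow> \<bar>(\<Sum>k\<le>n. measure \<nu> ((T ^^ k) -` B \<inter> space M)) - a (Suc n) * measure M B\<bar> \<le> \<epsilon> * (a (Suc n) * measure M B)) sequentially"
    if \<epsilon>: "0 < \<epsilon>" for \<epsilon>
  proof -
    have "eventually (\<lambda>n. \<forall>x\<in>A - N. dist (1 / a (Suc n) * S (Suc n) x) 1 < \<epsilon>) sequentially"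
      by (rule eventually_compose_filterlim[OF uniform_limitD[OF unif \<epsilon>] filterlim_Suc])
    then show ?thesis
    proof eventually_elim
      case (elim n)
      show ?case using bound[OF elim] by blast
    qed
  qed
  \<comment> \<open>The sum over k \<le> n has n + 1 terms, hence the shift of the given normalizing
    sequence by one.\<close>
  show ?thesis
    by (rule that[of "\<lambda>n. a (Suc n)", OF a ev])
qed

end

section \<open>Asymptotics of the normalizing sequence and convergence to the uniform law\<close>

section \<open>The law of the last visit\<close>

text \<open>For x outside (0, 1), monotonicity compares F n x with F n u for u in (0, 1) close to
  the nearer endpoint.\<close>

lemma cdf_tendsto_uniform:
  fixes F :: "nat \<Rightarrow> real \<Rightarrow> real"
  assumes mono: "\<And>n. mono (F n)" and range: "\<And>n x. 0 \<le> F n x" "\<And>n x. F n x \<le> 1"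
    and lim: "\<And>u. \<lbrakk>0 < u; u < 1\<rbrakk> \<Longrightarrow> (\<lambda>n. F n u) \<longlonglongrightarrow> u"
  shows "(\<lambda>n. F n x) \<longlonglongrightarrow> min 1 (max 0 x)"
proof (rule order_tendstoI)
  fix a assume a: "a < min 1 (max 0 x)"
  show "eventually (\<lambda>n. a < F n x) sequentially"
  proof (cases "a < 0")
    case True
    then show ?thesis using range(1) by (intro always_eventually allI) (rule less_le_trans)
  next
    case False
    then have x: "a < x" "a < 1" "0 < x" using a by (auto simp: min_def max_def split: if_splits)
    then obtain u where u: "a < u" "u < min 1 x" using dense[of a "min 1 x"] by auto
    then have "eventually (\<lambda>n. a < F n u) sequentially"
      using False by (intro order_tendstoD(1)[OF lim]) auto
    then show ?thesis
      by eventually_elim (use u monoD[OF mono, of u x] in \<open>fastforce intro: less_le_trans\<close>)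
  qed
next
  fix a assume a: "min 1 (max 0 x) < a"
  show "eventually (\<lambda>n. F n x < a) sequentially"
  proof (cases "1 < a")
    case True
    then show ?thesis using range(2) by (intro always_eventually allI) (rule le_less_trans)
  next
    case False
    then have x: "x < a" "0 < a" "x < 1" using a by (auto simp: min_def max_def split: if_splits)
    then obtain u where u: "u < a" "max 0 x < u" using dense[of "max 0 x" a] by auto
    then have "eventually (\<lambda>n. F n u < a) sequentially"
      using False by (intro order_tendstoD(2)[OF lim]) auto
    then show ?thesis
      by eventually_elim (use u monoD[OF mono, of x u] in \<open>fastforce intro: le_less_trans\<close>)
  qed
qed

lemma cdf_uniform_unit_interval: "cdf (uniform_measure lborel {0..1}) x = min 1 (max 0 x)"
proof -
  have "{0..1} \<inter> {..x} = {0..min 1 x}" by auto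
  then have "cdf (uniform_measure lborel {0..1}) x = measure lborel {0..min 1 x}"
    by (simp add: cdf_def measure_uniform_measure)
  then show ?thesis by (cases "0 \<le> x") (auto simp: min_def max_def)
qed

text \<open>The witness f of uniformity is fixed because all quantitative estimates are made under
  its density. Regular variation is recorded in the doubling form used with the monotone sequence
  w.\<close>

locale uniform_set_visits = conservative_ergodic_system +
  fixes A :: "'a set" and f :: "'a \<Rightarrow> real"
  assumes unif: "uniform_set_for M T A f"
    and W2: "(\<lambda>n. wandering_rate M T A (2 * n) / wandering_rate M T A n) \<longlonglongrightarrow> 2"
begin

abbreviation "w n \<equiv> measure M (excursion_set M T A n)"
abbreviation "W n \<equiv> wandering_rate M T A n"

lemma A_sets [measurable]: "A \<in> sets M"
  and A_pos: "0 < emeasure M A" and A_finite: "emeasure M A < \<infinity>"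
  using unif by (auto simp: uniform_set_for_def)

lemma w_decseq: "decseq (\<lambda>n. w n)"
proof -
  have "emeasure M (excursion_set M T A i) \<noteq> \<infinity>" for i
    using emeasure_mono[OF excursion_set_subset[OF A_sets, of i] A_sets] A_finite by (auto simp: top_unique)
  then show ?thesis
    unfolding decseq_def using excursion_set_antimono[OF A_sets]
    by (auto intro!: measure_mono_fmeasurable simp: fmeasurable_def excursion_set_sets[OF A_sets] top.not_eq_extremum)
qed

lemma w_0_pos: "0 < w 0"
proof -
  have "excursion_set M T A 0 = A" using sets.sets_into_space[OF A_sets] by (auto simp: excursion_set_def no_visit_def)
  then show ?thesis using A_pos A_finite by (simp add: measure_def enn2real_positive_iff)
qed

lemma w_W_limit: "(\<lambda>n. real n * w n / W n) \<longlonglongrightarrow> 1"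
  by (rule monotone_density_sequence[OF w_decseq _ w_0_pos wandering_rate_eq_sum[OF A_sets A_finite] W2]) simp

text \<open>The limit 1 of n w n / W n gives indices beyond any n at which w is nonzero;
  monotonicity passes this down to n.\<close>

lemma w_pos: "0 < w n"
proof -
  have "eventually (\<lambda>k. 0 < real k * w k / W k) sequentially"
    using w_W_limit by (rule order_tendstoD) simp
  then have "eventually (\<lambda>k. 0 < real k * w k / W k \<and> n \<le> k) sequentially"
    using eventually_ge_at_top by (rule eventually_conj)
  then obtain k where "0 < real k * w k / W k" "n \<le> k" by (auto simp: eventually_sequentially)
  then have "w k \<noteq> 0" "w k \<le> w n" using decseqD[OF w_decseq] by auto
  then show ?thesis using measure_nonneg[of M "excursion_set M T A k"] by linarith
qed

lemma W_pos: "0 < W n"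
  unfolding wandering_rate_eq_sum[OF A_sets A_finite] by (intro sum_pos w_pos) auto

lemma w_slow: "(\<lambda>n. w (n div 2) / w n) \<longlonglongrightarrow> 1"
  by (rule slow_variation_of_density[OF w_decseq w_pos W_pos w_W_limit W2])

lemma w_tendsto_0: "(\<lambda>n. w n) \<longlonglongrightarrow> 0"
  by (rule measure_excursion_set_tendsto_0[OF A_sets A_finite])

lemma AE_visits: "AE x in M. \<forall>n. \<exists>k\<ge>n. (T ^^ k) x \<in> A"
  using recurrence[OF A_sets] A_pos by auto

text \<open>With m fixed, this makes negligible the points whose last visit is too early for
  asymptotic information about L to apply.\<close>

lemma no_visit_probability_tendsto_0:
  assumes \<nu>: "\<nu> \<in> ac_prob M"
  shows "(\<lambda>n. measure \<nu> (no_visit M T A m n)) \<longlonglongrightarrow> 0"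
proof -
  interpret \<nu>: prob_space \<nu> using \<nu> by (simp add: ac_prob_def)
  have s: "sets \<nu> = sets M" using \<nu> by (simp add: ac_prob_def)
  have "(\<lambda>n. measure \<nu> (no_visit M T A m n)) \<longlonglongrightarrow> measure \<nu> (\<Inter>n. no_visit M T A m n)"
    using no_visit_sets[OF A_sets]
    by (intro \<nu>.finite_Lim_measure_decseq) (auto simp: s decseq_def no_visit_def)
  moreover have "AE x in \<nu>. \<forall>n. \<exists>k\<ge>n. (T ^^ k) x \<in> A"
    using \<nu> AE_visits by (intro absolutely_continuous_AE[OF s]) (auto simp: ac_prob_def)
  then have "AE x in \<nu>. x \<notin> (\<Inter>n. no_visit M T A m n)"
  proof eventually_elim
    case (elim x)
    then obtain k where "k \<ge> Suc m" "(T ^^ k) x \<in> A" by blast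
    then have "x \<notin> no_visit M T A m k" by (auto simp: no_visit_def intro!: exI[of _ k])
    then show ?case by blast
  qed
  then have "measure \<nu> (\<Inter>n. no_visit M T A m n) = 0"
    using no_visit_sets[OF A_sets] by (subst \<nu>.prob_eq_0) (auto simp: s)
  ultimately show ?thesis by simp
qed

abbreviation "\<nu>\<^sub>0 \<equiv> density M (\<lambda>x. ennreal (f x))"

lemma nu_ac_prob: "\<nu>\<^sub>0 \<in> ac_prob M"
  and f_measurable: "f \<in> borel_measurable M" and f_nonneg: "AE x in M. 0 \<le> f x"
  using unif by (auto simp: uniform_set_for_def ac_prob_density_def)

lemma prob_space_nu: "prob_space \<nu>\<^sub>0"
  using nu_ac_prob by (simp add: ac_prob_def)

lemmas f_density = prob_density_properties[OF f_measurable f_nonneg prob_space_nu]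

lemma measure_not_hit: "measure \<nu>\<^sub>0 (space M - hit_set M T A n) = 1 - measure \<nu>\<^sub>0 (hit_set M T A n)"
proof -
  interpret \<nu>\<^sub>0: prob_space \<nu>\<^sub>0 by (rule prob_space_nu)
  show ?thesis using \<nu>\<^sub>0.prob_compl[of "hit_set M T A n"] hit_set_sets[OF A_sets] by simp
qed

lemma hit_probability_tendsto_1: "(\<lambda>n. measure \<nu>\<^sub>0 (hit_set M T A n)) \<longlonglongrightarrow> 1"
proof (rule tendsto_sandwich[OF _ _ _ tendsto_const])
  interpret \<nu>\<^sub>0: prob_space \<nu>\<^sub>0 by (rule prob_space_nu)
  have "1 - measure \<nu>\<^sub>0 (no_visit M T A 0 n) \<le> measure \<nu>\<^sub>0 (hit_set M T A n)" for n
  proof -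
    have "space M - hit_set M T A n \<subseteq> no_visit M T A 0 n" by (auto simp: hit_set_def no_visit_def)
    then have "measure \<nu>\<^sub>0 (space M - hit_set M T A n) \<le> measure \<nu>\<^sub>0 (no_visit M T A 0 n)"
      using no_visit_sets[OF A_sets] by (intro \<nu>\<^sub>0.finite_measure_mono) simp_all
    then show ?thesis by (simp add: measure_not_hit)
  qed
  then show "eventually (\<lambda>n. 1 - measure \<nu>\<^sub>0 (no_visit M T A 0 n) \<le> measure \<nu>\<^sub>0 (hit_set M T A n)) sequentially"
    by simp
  show "eventually (\<lambda>n. measure \<nu>\<^sub>0 (hit_set M T A n) \<le> 1) sequentially" by simp
  show "(\<lambda>n. 1 - measure \<nu>\<^sub>0 (no_visit M T A 0 n)) \<longlonglongrightarrow> 1"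
    using tendsto_diff[OF tendsto_const no_visit_probability_tendsto_0[OF nu_ac_prob], of 1] by simp
qed

lemma measure_last_visit:
  assumes "m \<le> n"
  shows "measure \<nu>\<^sub>0 (hit_set M T A n \<inter> no_visit M T A m n) =
    (\<Sum>k\<le>m. measure \<nu>\<^sub>0 ((T ^^ k) -` excursion_set M T A (n - k) \<inter> space M))"
proof -
  interpret \<nu>\<^sub>0: prob_space \<nu>\<^sub>0 by (rule prob_space_nu)
  show ?thesis
    using emeasure_last_visit[OF A_sets assms, of \<nu>\<^sub>0]
    by (simp add: \<nu>\<^sub>0.emeasure_eq_measure sum_nonneg)
qed

lemma measure_no_visit:
  "measure \<nu>\<^sub>0 (no_visit M T A m n) = (1 - measure \<nu>\<^sub>0 (hit_set M T A n)) + measure \<nu>\<^sub>0 (hit_set M T A n \<inter> no_visit M T A m n)"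
proof -
  interpret \<nu>\<^sub>0: prob_space \<nu>\<^sub>0 by (rule prob_space_nu)
  have "measure \<nu>\<^sub>0 ((space M - hit_set M T A n) \<union> (hit_set M T A n \<inter> no_visit M T A m n)) =
      measure \<nu>\<^sub>0 (space M - hit_set M T A n) + measure \<nu>\<^sub>0 (hit_set M T A n \<inter> no_visit M T A m n)"
    using no_visit_sets[OF A_sets] hit_set_sets[OF A_sets] by (intro \<nu>\<^sub>0.finite_measure_Union) auto
  then show ?thesis by (simp add: hit_set_Un_no_visit measure_not_hit)
qed

text \<open>
  The upper bound comes from decomposing a single event $A_n$ according to the last visit; the lower
  bound comes from summing these decompositions over $n$, which makes the wandering rate appear.
\<close>

lemma normalizer_asymptotics:
  assumes a: "\<And>n. 0 < a n"
    and visits: "\<And>\<epsilon>. 0 < \<epsilon> \<Longrightarrow> eventually (\<lambda>n. \<forall>B\<in>sets M. B \<subseteq> A \<longrightarrow>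
       \<bar>(\<Sum>k\<le>n. measure \<nu>\<^sub>0 ((T ^^ k) -` B \<inter> space M)) - a n * measure M B\<bar> \<le> \<epsilon> * (a n * measure M B)) sequentially"
  shows "(\<lambda>n. a n * w n) \<longlonglongrightarrow> 1"
proof (rule relative_squeeze[OF w_W_limit tendsto_const])
  interpret \<nu>\<^sub>0: prob_space \<nu>\<^sub>0 by (rule prob_space_nu)
  note C = excursion_set_sets[OF A_sets] and CA = excursion_set_subset[OF A_sets]
  define Q where "Q k j = measure \<nu>\<^sub>0 ((T ^^ k) -` excursion_set M T A j \<inter> space M)" for k j
  have Q_nonneg: "0 \<le> Q k j" for k j by (simp add: Q_def)
  have Q_antimono: "Q k j \<le> Q k i" if "i \<le> j" for i j k
    unfolding Q_def using excursion_set_antimono[OF A_sets that] measurable_sets[OF measurable_funpow C]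
    by (intro \<nu>\<^sub>0.finite_measure_mono) auto
  have hit: "measure \<nu>\<^sub>0 (hit_set M T A n) = (\<Sum>k\<le>n. Q k (n - k))" for n
    using measure_last_visit[of n n] by (simp add: hit_set_Int_no_visit[OF A_sets] Q_def)
  fix \<epsilon> :: real assume \<epsilon>: "0 < \<epsilon>" "\<epsilon> < 1"
  show "eventually (\<lambda>n. (1 - \<epsilon>) * (a n * w n) \<le> (1 + \<epsilon>) * 1) sequentially"
    using visits[OF \<epsilon>(1)]
  proof eventually_elim
    case (elim n)
    have "\<bar>(\<Sum>k\<le>n. Q k n) - a n * w n\<bar> \<le> \<epsilon> * (a n * w n)"
      using elim[rule_format, OF C CA] by (simp add: Q_def)
    then have "(1 - \<epsilon>) * (a n * w n) \<le> (\<Sum>k\<le>n. Q k n)"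
      unfolding abs_le_iff left_diff_distrib by simp
    \<comment> \<open>Lowering the index from n to n - k enlarges the excursion set, and the
      enlarged sum is the exact probability of a visit up to n.\<close>
    also have "\<dots> \<le> (\<Sum>k\<le>n. Q k (n - k))"
      by (intro sum_mono Q_antimono) simp
    also have "\<dots> \<le> 1" using \<nu>\<^sub>0.prob_le_1[of "hit_set M T A n"] by (simp add: hit)
    finally show ?case using \<epsilon> by simp
  qed
  show "eventually (\<lambda>n. (1 - \<epsilon>) * (real n * w n / W n) \<le> (1 + \<epsilon>) * (a n * w n)) sequentially"
    using visits[OF \<epsilon>(1)] eventually_partial_sum_ge[OF hit_probability_tendsto_1 measure_nonneg \<epsilon>]
  proof eventually_elim
    case (elim n)
    have "(1 - \<epsilon>) * real n \<le> (\<Sum>j\<le>n. \<Sum>k\<le>j. Q k (j - k))"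
      using elim(2) by (simp add: hit)
    also have "\<dots> = (\<Sum>(k, i)\<in>{(k, i). k + i \<le> n}. Q k i)"
      by (rule sum.triangle_reindex_eq[symmetric])
    \<comment> \<open>Passing from the triangle k + i \<le> n to the square leaves, for each i, all
      visits to one fixed set up to time n. The same \<open>a n\<close> then governs every term, and
      the w i add up to W n.\<close>
    also have "\<dots> \<le> (\<Sum>(k, i)\<in>{..n} \<times> {..n}. Q k i)"
      by (rule sum_mono2) (auto simp: Q_nonneg)
    also have "\<dots> = (\<Sum>i\<le>n. \<Sum>k\<le>n. Q k i)"
      unfolding sum.cartesian_product[symmetric] by (rule sum.swap)
    also have "\<dots> \<le> (\<Sum>i\<le>n. (1 + \<epsilon>) * a n * w i)"
    proof (rule sum_mono)
      fix i
      have "\<bar>(\<Sum>k\<le>n. Q k i) - a n * w i\<bar> \<le> \<epsilon> * (a n * w i)"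
        using elim(1)[rule_format, OF C CA] by (simp add: Q_def)
      then show "(\<Sum>k\<le>n. Q k i) \<le> (1 + \<epsilon>) * a n * w i"
        by (simp add: abs_le_iff algebra_simps)
    qed
    also have "\<dots> = (1 + \<epsilon>) * a n * W n"
      by (simp add: wandering_rate_eq_sum[OF A_sets A_finite] sum_distrib_left)
    finally have "(1 - \<epsilon>) * real n * (w n / W n) \<le> (1 + \<epsilon>) * a n * W n * (w n / W n)"
      using w_pos W_pos by (intro mult_right_mono) (auto simp: less_imp_le)
    then show ?case using W_pos[of n] by (simp add: mult_ac)
  qed
qed

text \<open>For k \<le> m n \<le> n/2 the index n - k lies between n div 2 and n, so H n lies
  between sums over visits to a single set, namely about a(m n) w(n) and a(m n) w(n div 2). Both
  tend to u because a(m n) w(m n) tends to 1.\<close>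

lemma visit_law_nu:
  assumes m: "filterlim m at_top at_top" "eventually (\<lambda>n. m n \<le> n div 2) sequentially"
    and u: "(\<lambda>n. w n / w (m n)) \<longlonglongrightarrow> u"
  shows "(\<lambda>n. measure \<nu>\<^sub>0 (no_visit M T A (m n) n)) \<longlonglongrightarrow> u"
proof -
  interpret \<nu>\<^sub>0: prob_space \<nu>\<^sub>0 by (rule prob_space_nu)
  obtain a :: "nat \<Rightarrow> real" where a: "\<And>n. 0 < a n"
    and visits: "\<And>\<epsilon>. 0 < \<epsilon> \<Longrightarrow> eventually (\<lambda>n. \<forall>B\<in>sets M. B \<subseteq> A \<longrightarrow>
       \<bar>(\<Sum>k\<le>n. measure \<nu>\<^sub>0 ((T ^^ k) -` B \<inter> space M)) - a n * measure M B\<bar> \<le> \<epsilon> * (a n * measure M B)) sequentially"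
    using uniform_set_for_visits[OF unif] by blast
  note C = excursion_set_sets[OF A_sets] and CA = excursion_set_subset[OF A_sets]
  have aw: "(\<lambda>n. a (m n) * w (m n)) \<longlonglongrightarrow> 1"
    using normalizer_asymptotics[OF a visits] m(1) by (rule filterlim_compose)
  define Q where "Q k j = measure \<nu>\<^sub>0 ((T ^^ k) -` excursion_set M T A j \<inter> space M)" for k j
  have Q_antimono: "Q k j \<le> Q k i" if "i \<le> j" for i j k
    unfolding Q_def using excursion_set_antimono[OF A_sets that] measurable_sets[OF measurable_funpow C]
    by (intro \<nu>\<^sub>0.finite_measure_mono) auto
  define H where "H n = measure \<nu>\<^sub>0 (hit_set M T A n \<inter> no_visit M T A (m n) n)" for n
  have H: "eventually (\<lambda>n. H n = (\<Sum>k\<le>m n. Q k (n - k))) sequentially"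
    using m(2) by eventually_elim (simp add: H_def Q_def measure_last_visit)
  have ev: "eventually (\<lambda>n. \<forall>j. \<bar>(\<Sum>k\<le>m n. Q k j) - a (m n) * w j\<bar> \<le> \<epsilon> * (a (m n) * w j)) sequentially"
    if "0 < \<epsilon>" for \<epsilon>
    using eventually_compose_filterlim[OF visits[OF that] m(1)]
  proof eventually_elim
    case (elim n)
    show ?case using elim[rule_format, OF C CA] by (simp add: Q_def)
  qed
  have lo: "(\<lambda>n. a (m n) * w n) \<longlonglongrightarrow> u"
  proof (rule Lim_transform_eventually)
    show "(\<lambda>n. (a (m n) * w (m n)) * (w n / w (m n))) \<longlonglongrightarrow> u" using tendsto_mult[OF aw u] by simp
    have "w (m n) \<noteq> 0" for n using w_pos[of "m n"] by simp
    then show "eventually (\<lambda>n. (a (m n) * w (m n)) * (w n / w (m n)) = a (m n) * w n) sequentially"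
      by (intro always_eventually allI) simp
  qed
  have hi: "(\<lambda>n. a (m n) * w (n div 2)) \<longlonglongrightarrow> u"
  proof (rule Lim_transform_eventually)
    show "(\<lambda>n. (a (m n) * w n) * (w (n div 2) / w n)) \<longlonglongrightarrow> u" using tendsto_mult[OF lo w_slow] by simp
    have "w n \<noteq> 0" for n using w_pos[of n] by simp
    then show "eventually (\<lambda>n. (a (m n) * w n) * (w (n div 2) / w n) = a (m n) * w (n div 2)) sequentially"
      by (intro always_eventually allI) simp
  qed
  have "H \<longlonglongrightarrow> u"
  proof (rule relative_squeeze[OF lo hi])
    fix \<epsilon> :: real assume \<epsilon>: "0 < \<epsilon>" "\<epsilon> < 1"
    have H_nonneg: "0 \<le> H n" for n by (simp add: H_def)
    show "eventually (\<lambda>n. (1 - \<epsilon>) * (a (m n) * w n) \<le> (1 + \<epsilon>) * H n) sequentially"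
      using ev[OF \<epsilon>(1)] H
    proof eventually_elim
      case (elim n)
      have "(1 - \<epsilon>) * (a (m n) * w n) \<le> (\<Sum>k\<le>m n. Q k n)"
        using elim(1)[rule_format, of n] unfolding abs_le_iff left_diff_distrib by simp
      also have "\<dots> \<le> H n" unfolding elim(2) by (intro sum_mono Q_antimono) simp
      also have "\<dots> \<le> (1 + \<epsilon>) * H n" using \<epsilon> H_nonneg[of n] by (simp add: algebra_simps)
      finally show ?case .
    qed
    show "eventually (\<lambda>n. (1 - \<epsilon>) * H n \<le> (1 + \<epsilon>) * (a (m n) * w (n div 2))) sequentially"
      using ev[OF \<epsilon>(1)] H m(2)
    proof eventually_elim
      case (elim n)
      have "(1 - \<epsilon>) * H n \<le> H n" using \<epsilon> H_nonneg[of n] by (simp add: algebra_simps)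
      also have "\<dots> \<le> (\<Sum>k\<le>m n. Q k (n div 2))"
        unfolding elim(2) using elim(3) by (intro sum_mono Q_antimono) auto
      also have "\<dots> \<le> (1 + \<epsilon>) * (a (m n) * w (n div 2))"
        using elim(1)[rule_format, of "n div 2"] unfolding abs_le_iff distrib_right by simp
      finally show ?case .
    qed
  qed
  from tendsto_add[OF tendsto_diff[OF tendsto_const hit_probability_tendsto_1] this, of 1]
  show ?thesis by (simp add: measure_no_visit H_def)
qed

lemmas f_facts = f_measurable f_nonneg f_density
lemmas ratio_index = exists_ratio_index[OF w_decseq w_pos w_tendsto_0 w_slow]

text \<open>A visit at time n excludes the event Z_n \<le> m n whenever m n < n, and for suitable m
  this event has probability close to any u < 1.\<close>

lemma visit_probability_tendsto_0:
  "(\<lambda>n. measure \<nu>\<^sub>0 ((T ^^ n) -` A \<inter> space M)) \<longlonglongrightarrow> 0"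
proof (rule order_tendstoI)
  interpret \<nu>: prob_space \<nu>\<^sub>0 by (rule prob_space_nu)
  fix b :: real
  show "eventually (\<lambda>n. b < measure \<nu>\<^sub>0 ((T ^^ n) -` A \<inter> space M)) sequentially" if "b < 0"
    using that measure_nonneg[of \<nu>\<^sub>0] by (intro always_eventually allI) (rule less_le_trans)
  assume "0 < b"
  \<comment> \<open>The term 1 - b/2 gives 1 - b < u < 1; the maximum with 1/2 keeps u positive when
    b is large.\<close>
  define u where "u = max (1 / 2) (1 - b / 2)"
  have u: "0 < u" "u < 1" "1 - b < u" using \<open>0 < b\<close> by (auto simp: u_def max_def)
  obtain m where m: "filterlim m at_top at_top"
    "(\<lambda>n. measure M (excursion_set M T A n) / measure M (excursion_set M T A (m n))) \<longlonglongrightarrow> u"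
    "eventually (\<lambda>n. m n < n) sequentially" "eventually (\<lambda>n. m n \<le> n div 2) sequentially"
    by (rule ratio_index[OF u(1,2)])
  have "eventually (\<lambda>n. 1 - b < measure \<nu>\<^sub>0 (no_visit M T A (m n) n)) sequentially"
    using visit_law_nu[OF m(1,4,2)] u(3) by (rule order_tendstoD)
  then show "eventually (\<lambda>n. measure \<nu>\<^sub>0 ((T ^^ n) -` A \<inter> space M) < b) sequentially"
    using m(3)
  proof eventually_elim
    case (elim n)
    have "(T ^^ n) -` A \<inter> space M \<subseteq> space M - no_visit M T A (m n) n"
      using elim(2) by (auto simp: no_visit_def)
    then have "measure \<nu>\<^sub>0 ((T ^^ n) -` A \<inter> space M) \<le> measure \<nu>\<^sub>0 (space M - no_visit M T A (m n) n)"
      using no_visit_sets[OF A_sets] by (intro \<nu>.finite_measure_mono) auto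
    also have "\<dots> = 1 - measure \<nu>\<^sub>0 (no_visit M T A (m n) n)"
      using \<nu>.prob_compl[of "no_visit M T A (m n) n"] no_visit_sets[OF A_sets] by simp
    finally show ?case using elim(1) by simp
  qed
qed

text \<open>Shifting by k merely turns a visit at time n into one at time n + k, so convergence
  under f already covers all shifts.\<close>

lemma visit_integral_tendsto_0:
  fixes h :: "'a \<Rightarrow> real"
  assumes h: "integrable M h" "AE x in M. 0 \<le> h x"
  shows "(\<lambda>n. \<integral>x. indicator A ((T ^^ n) x) * h x \<partial>M) \<longlonglongrightarrow> 0"
proof (rule strong_null_convergence_of_integrals[OF _ _ _ f_facts(3,2,4) _ h])
  note [measurable] = A_sets
  show "(\<lambda>x. indicator A ((T ^^ n) x)) \<in> borel_measurable M" for n by measurable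
  fix k
  have "(\<integral>x. indicator A ((T ^^ n) ((T ^^ k) x)) * f x \<partial>M) =
      measure \<nu>\<^sub>0 ((T ^^ (n + k)) -` A \<inter> space M)" for n
  proof -
    have "measure \<nu>\<^sub>0 ((T ^^ (n + k)) -` A \<inter> space M) =
        (\<integral>x. indicator ((T ^^ (n + k)) -` A \<inter> space M) x * f x \<partial>M)"
      by (rule f_facts(5)) measurable
    also have "\<dots> = (\<integral>x. indicator A ((T ^^ n) ((T ^^ k) x)) * f x \<partial>M)"
      by (intro Bochner_Integration.integral_cong) (auto simp: indicator_def funpow_add)
    finally show ?thesis ..
  qed
  then show "(\<lambda>n. \<integral>x. indicator A ((T ^^ n) ((T ^^ k) x)) * f x \<partial>M) \<longlonglongrightarrow> 0"
    using LIMSEQ_ignore_initial_segment[OF visit_probability_tendsto_0, of k] by simp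
qed auto

proposition visit_law:
  assumes m: "filterlim m at_top at_top" "eventually (\<lambda>n. m n \<le> n div 2) sequentially"
    and u: "(\<lambda>n. measure M (excursion_set M T A n) / measure M (excursion_set M T A (m n))) \<longlonglongrightarrow> u"
    and \<nu>: "\<nu> \<in> ac_prob M"
  shows "(\<lambda>n. measure \<nu> (no_visit M T A (m n) n)) \<longlonglongrightarrow> u"
proof -
  note [measurable] = A_sets no_visit_sets[OF A_sets] measurable_T
  obtain h :: "'a \<Rightarrow> real" where h: "h \<in> borel_measurable M" "\<forall>x. 0 \<le> h x"
    and \<nu>_eq: "\<nu> = density M (\<lambda>x. ennreal (h x))"
    using ac_prob_density_exists[OF \<nu>] by blast
  have hn: "AE x in M. 0 \<le> h x" using h(2) by simp
  have "prob_space (density M (\<lambda>x. ennreal (h x)))" using \<nu> by (simp add: \<nu>_eq ac_prob_def)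
  note hp = prob_density_properties[OF h(1) hn this]
  have "(\<lambda>n. \<integral>x. indicator (no_visit M T A (m n) n) x * h x \<partial>M) \<longlonglongrightarrow> u"
  proof (rule strong_convergence_of_integrals[OF _ _ _ _ f_facts(3,2,4) _ hp(1) hn hp(2)])
    show "(\<lambda>n. \<integral>x. indicator (no_visit M T A (m n) n) x * f x \<partial>M) \<longlonglongrightarrow> u"
      using visit_law_nu[OF m u] by (simp add: f_facts(5))
  next
    fix k :: "'a \<Rightarrow> real" assume k: "integrable M k" "\<And>x. 0 \<le> k x"
    then have k': "AE x in M. 0 \<le> k x" by simp
    define v where "v n = (\<integral>x. indicator A ((T ^^ n) x) * k x \<partial>M)" for n
    have v: "v \<longlonglongrightarrow> 0" unfolding v_def by (rule visit_integral_tendsto_0[OF k(1) k'])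
    have i: "integrable M (\<lambda>x. g x * k x)" if "g \<in> borel_measurable M" "\<And>x. 0 \<le> g x" "\<And>x. g x \<le> 1" for g :: "'a \<Rightarrow> real"
      by (rule integrable_unit_interval_mult[OF k(1) that])
    show "(\<lambda>n. (\<integral>x. indicator (no_visit M T A (m n) n) (T x) * k x \<partial>M) - (\<integral>x. indicator (no_visit M T A (m n) n) x * k x \<partial>M)) \<longlonglongrightarrow> 0"
    proof (rule Lim_null_comparison)
      show "(\<lambda>n. v (Suc n) + v (Suc (m n))) \<longlonglongrightarrow> 0"
        using tendsto_add[OF LIMSEQ_Suc[OF v] filterlim_compose[OF LIMSEQ_Suc[OF v] m(1)]] by simp
      have "norm ((\<integral>x. indicator (no_visit M T A (m n) n) (T x) * k x \<partial>M) - (\<integral>x. indicator (no_visit M T A (m n) n) x * k x \<partial>M))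
          \<le> v (Suc n) + v (Suc (m n))" for n
      proof -
        let ?E = "no_visit M T A (m n) n"
        have i1: "integrable M (\<lambda>x. indicator ?E (T x) * k x)" "integrable M (\<lambda>x. indicator ?E x * k x)"
          "integrable M (\<lambda>x. indicator A ((T ^^ j) x) * k x)" for j
          by (rule i; auto)+
        have "(\<integral>x. indicator ?E (T x) * k x \<partial>M) - (\<integral>x. indicator ?E x * k x \<partial>M) = (\<integral>x. indicator ?E (T x) * k x - indicator ?E x * k x \<partial>M)"
          using i1 by simp
        then have "norm ((\<integral>x. indicator ?E (T x) * k x \<partial>M) - (\<integral>x. indicator ?E x * k x \<partial>M))
            \<le> (\<integral>x. norm (indicator ?E (T x) * k x - indicator ?E x * k x) \<partial>M)"
          using integral_norm_bound[of M "\<lambda>x. indicator ?E (T x) * k x - indicator ?E x * k x"] by simp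
        also have "\<dots> \<le> (\<integral>x. indicator A ((T ^^ Suc n) x) * k x + indicator A ((T ^^ Suc (m n)) x) * k x \<partial>M)"
        proof (rule integral_mono)
          show "integrable M (\<lambda>x. norm (indicator ?E (T x) * k x - indicator ?E x * k x))"
            by (intro integrable_norm Bochner_Integration.integrable_diff i1)
          show "integrable M (\<lambda>x. indicator A ((T ^^ Suc n) x) * k x + indicator A ((T ^^ Suc (m n)) x) * k x)"
            by (intro Bochner_Integration.integrable_add i1)
          fix x assume x: "x \<in> space M"
          \<comment> \<open>Under T the window (m n, n] becomes (m n + 1, n + 1]; the two windows
            can differ only at the times m n + 1 and n + 1.\<close>
          have "T x \<in> ?E \<longleftrightarrow> x \<in> ?E" if "(T ^^ Suc n) x \<notin> A" "(T ^^ Suc (m n)) x \<notin> A"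
            unfolding vimage_no_visit[OF A_sets x]
            using that x unfolding no_visit_def mem_Collect_eq
            by (metis Suc_lessI le_SucE le_SucI Suc_lessD)
          then show "norm (indicator ?E (T x) * k x - indicator ?E x * k x)
              \<le> indicator A ((T ^^ Suc n) x) * k x + indicator A ((T ^^ Suc (m n)) x) * k x"
            using k(2)[of x] by (auto simp: indicator_def)
        qed
        also have "\<dots> = v (Suc n) + v (Suc (m n))"
          unfolding v_def by (intro Bochner_Integration.integral_add i1)
        finally show ?thesis .
      qed
      then show "eventually (\<lambda>n. norm ((\<integral>x. indicator (no_visit M T A (m n) n) (T x) * k x \<partial>M) - (\<integral>x. indicator (no_visit M T A (m n) n) x * k x \<partial>M))
          \<le> v (Suc n) + v (Suc (m n))) sequentially"
        by simp
    qed
  qed auto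
  then show ?thesis by (simp add: \<nu>_eq hp(3))
qed

text \<open>Choosing t strictly between the target b and u leaves a multiplicative gap, and
  \<epsilon> is chosen so that the relative errors of L w at Z_n and at n both fit into it.\<close>

proposition last_visit_law:
  fixes L :: "real \<Rightarrow> real"
  assumes Lw: "(\<lambda>n. L (real n) * measure M (excursion_set M T A n)) \<longlonglongrightarrow> 1"
    and \<nu>: "\<nu> \<in> ac_prob M" and u: "0 < u" "u < 1"
  shows "(\<lambda>n. measure \<nu> {x \<in> space M. L (real (last_visit M T A n x)) / L (real n) \<le> u}) \<longlonglongrightarrow> u"
proof -
  interpret \<nu>: prob_space \<nu> using \<nu> by (simp add: ac_prob_def)
  have s: "sets \<nu> = sets M" using \<nu> by (simp add: ac_prob_def)
  note [measurable] = A_sets no_visit_sets[OF A_sets]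
  let ?w = "\<lambda>n. measure M (excursion_set M T A n)"
  let ?Z = "last_visit M T A"
  define R where "R n = {x \<in> space M. L (real (?Z n x)) / L (real n) \<le> u}" for n
  have R_sets: "R n \<in> sets \<nu>" for n unfolding R_def s by measurable
  have E_sets: "no_visit M T A i n \<in> sets \<nu>" for i n unfolding s by measurable
  note wpos = w_pos and dec = decseqD[OF w_decseq]
  have approx: "\<exists>K. \<forall>z\<ge>K. 1 - \<epsilon> < L (real z) * ?w z \<and> L (real z) * ?w z < 1 + \<epsilon>" if "0 < \<epsilon>" for \<epsilon>
    using eventually_conj[OF order_tendstoD(1)[OF Lw, of "1 - \<epsilon>"] order_tendstoD(2)[OF Lw, of "1 + \<epsilon>"]] that
    by (auto simp: eventually_sequentially)
  have "(\<lambda>n. measure \<nu> (R n)) \<longlonglongrightarrow> u"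
  proof (rule order_tendstoI)
    fix b assume "b < u"
    \<comment> \<open>The bound b may be negative, but t has to be a positive level for the ratio
      index to exist.\<close>
    then obtain t where t: "max 0 b < t" "t < u" using dense[of "max 0 b" u] u by auto
    then have t': "0 < t" "t < 1" "b < t" using u by auto
    obtain \<epsilon> where \<epsilon>: "0 < \<epsilon>" "\<epsilon> < 1" "(1 + \<epsilon>) * t \<le> (1 - \<epsilon>) * u" using separating_factor[OF t'(1) t(2)] .
    obtain K where K: "\<And>z. z \<ge> K \<Longrightarrow> 1 - \<epsilon> < L (real z) * ?w z \<and> L (real z) * ?w z < 1 + \<epsilon>" using approx[OF \<epsilon>(1)] by blast
    obtain m where m: "filterlim m at_top at_top" "(\<lambda>n. ?w n / ?w (m n)) \<longlonglongrightarrow> t"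
      "eventually (\<lambda>n. ?w n \<le> t * ?w (m n)) sequentially" "eventually (\<lambda>n. m n \<le> n div 2) sequentially"
      by (rule ratio_index[OF t'(1,2)])
    have "(\<lambda>n. measure \<nu> (no_visit M T A (m n) n) - measure \<nu> (no_visit M T A K n)) \<longlonglongrightarrow> t - 0"
      by (intro tendsto_diff visit_law[OF m(1,4,2) \<nu>] no_visit_probability_tendsto_0[OF \<nu>])
    then have "eventually (\<lambda>n. b < measure \<nu> (no_visit M T A (m n) n) - measure \<nu> (no_visit M T A K n)) sequentially"
      using t'(3) by (intro order_tendstoD(1)) auto
    then show "eventually (\<lambda>n. b < measure \<nu> (R n)) sequentially"
      using m(3) eventually_ge_at_top[of K]
    proof eventually_elim
      case (elim n)
      \<comment> \<open>Outside the exceptional set, z = Z_n satisfies K < z \<le> m n. Hence w n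
        \<le> t w(m n) \<le> t w z, and L may be replaced by 1/w at both z and n.\<close>
      have "no_visit M T A (m n) n \<subseteq> R n \<union> no_visit M T A K n"
      proof
        fix x assume x: "x \<in> no_visit M T A (m n) n"
        then have xs: "x \<in> space M" by (simp add: no_visit_def)
        define z where "z = ?Z n x"
        have "x \<in> R n" if "x \<notin> no_visit M T A K n"
        proof -
          have z: "z \<le> m n" "K < z" using x that unfolding z_def last_visit_le_iff[OF xs, symmetric] by auto
          have "L (real z) * ?w n \<le> L (real z) * (t * ?w z)"
          proof (rule mult_left_mono)
            show "?w n \<le> t * ?w z" by (rule order_trans[OF elim(2) mult_left_mono[OF dec[OF z(1)] less_imp_le[OF t'(1)]]])
            have "0 < L (real z) * ?w z" using K[of z] z \<epsilon>(2) by simp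
            then show "0 \<le> L (real z)" using wpos[of z] by (simp add: zero_less_mult_iff)
          qed
          also have "\<dots> = t * (L (real z) * ?w z)" by simp
          also have "\<dots> \<le> t * (1 + \<epsilon>)" using K[of z] z t'(1) by (intro mult_left_mono) auto
          also have "\<dots> \<le> u * (1 - \<epsilon>)" using \<epsilon>(3) by (simp add: mult.commute)
          also have "\<dots> \<le> u * (L (real n) * ?w n)" using K[of n] elim(3) u by (intro mult_left_mono) auto
          finally have "L (real z) * ?w n \<le> u * L (real n) * ?w n" by simp
          then have "L (real z) \<le> u * L (real n)" using wpos[of n] by simp
          moreover have "0 < L (real n) * ?w n" using K[of n] elim(3) \<epsilon>(2) by simp
          then have "0 < L (real n)" using wpos[of n] by (simp add: zero_less_mult_iff)
          ultimately show ?thesis using xs by (simp add: R_def z_def pos_divide_le_eq)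
        qed
        then show "x \<in> R n \<union> no_visit M T A K n" by blast
      qed
      then have "measure \<nu> (no_visit M T A (m n) n) \<le> measure \<nu> (R n \<union> no_visit M T A K n)"
        using R_sets E_sets by (intro \<nu>.finite_measure_mono) auto
      also have "\<dots> \<le> measure \<nu> (R n) + measure \<nu> (no_visit M T A K n)"
        using R_sets E_sets by (intro measure_Un_le)
      finally show ?case using elim(1) by simp
    qed
  next
    fix b assume "u < b"
    then obtain t where t: "u < t" "t < min 1 b" using dense[of u "min 1 b"] u by auto
    then have t': "0 < t" "t < 1" "t < b" using u by auto
    obtain \<epsilon> where \<epsilon>: "0 < \<epsilon>" "\<epsilon> < 1" "(1 + \<epsilon>) * u \<le> (1 - \<epsilon>) * t" using separating_factor[OF u(1) t(1)] .
    obtain K where K: "\<And>z. z \<ge> K \<Longrightarrow> 1 - \<epsilon> < L (real z) * ?w z \<and> L (real z) * ?w z < 1 + \<epsilon>" using approx[OF \<epsilon>(1)] by blast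
    obtain m where m: "filterlim m at_top at_top" "(\<lambda>n. ?w n / ?w (m n)) \<longlonglongrightarrow> t"
      "eventually (\<lambda>n. t * ?w (Suc (m n)) < ?w n) sequentially" "eventually (\<lambda>n. m n \<le> n div 2) sequentially"
      by (rule ratio_index[OF t'(1,2)])
    have "(\<lambda>n. measure \<nu> (no_visit M T A (m n) n) + measure \<nu> (no_visit M T A K n)) \<longlonglongrightarrow> t + 0"
      by (intro tendsto_add visit_law[OF m(1,4,2) \<nu>] no_visit_probability_tendsto_0[OF \<nu>])
    then have "eventually (\<lambda>n. measure \<nu> (no_visit M T A (m n) n) + measure \<nu> (no_visit M T A K n) < b) sequentially"
      using t'(3) by (intro order_tendstoD(2)) auto
    then show "eventually (\<lambda>n. measure \<nu> (R n) < b) sequentially"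
      using m(3) eventually_ge_at_top[of K]
    proof eventually_elim
      case (elim n)
      \<comment> \<open>Here z \<ge> m n + 1, and the failure of the defining inequality one step
        beyond m n gives t w z < w n.\<close>
      have "R n \<subseteq> no_visit M T A (m n) n \<union> no_visit M T A K n"
      proof
        fix x assume x: "x \<in> R n"
        then have xs: "x \<in> space M" by (simp add: R_def)
        define z where "z = ?Z n x"
        have False if "x \<notin> no_visit M T A (m n) n" "x \<notin> no_visit M T A K n"
        proof -
          have z: "Suc (m n) \<le> z" "K < z" using that unfolding z_def last_visit_le_iff[OF xs, symmetric] by auto
          have pos: "0 < L (real z) * ?w z" using K[of z] z \<epsilon>(2) by simp
          then have Lz: "0 < L (real z)" using wpos[of z] by (simp add: zero_less_mult_iff)
          have "0 < L (real n) * ?w n" using K[of n] elim(3) \<epsilon>(2) by simp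
          then have Ln: "0 < L (real n)" using wpos[of n] by (simp add: zero_less_mult_iff)
          have "(1 - \<epsilon>) * t \<le> (L (real z) * ?w z) * t" using K[of z] z t'(1) by (intro mult_right_mono) auto
          also have "\<dots> = L (real z) * (t * ?w z)" by simp
          also have "\<dots> < L (real z) * ?w n"
            by (rule mult_strict_left_mono[OF le_less_trans[OF mult_left_mono[OF dec[OF z(1)] less_imp_le[OF t'(1)]] elim(2)] Lz])
          also have "\<dots> \<le> (u * L (real n)) * ?w n"
            using x Ln wpos[of n] by (intro mult_right_mono) (auto simp: R_def z_def pos_divide_le_eq)
          also have "\<dots> = u * (L (real n) * ?w n)" by simp
          also have "\<dots> \<le> u * (1 + \<epsilon>)" using K[of n] elim(3) u by (intro mult_left_mono) auto
          finally show False using \<epsilon>(3) by (simp add: mult.commute)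
        qed
        then show "x \<in> no_visit M T A (m n) n \<union> no_visit M T A K n" by blast
      qed
      then have "measure \<nu> (R n) \<le> measure \<nu> (no_visit M T A (m n) n \<union> no_visit M T A K n)"
        using R_sets E_sets by (intro \<nu>.finite_measure_mono) auto
      also have "\<dots> \<le> measure \<nu> (no_visit M T A (m n) n) + measure \<nu> (no_visit M T A K n)"
        using E_sets by (intro measure_Un_le)
      finally show ?case using elim(1) by simp
    qed
  qed
  then show ?thesis by (simp add: R_def)
qed

end

theorem theorem1p5:
  fixes M :: "'a measure" and T :: "'a \<Rightarrow> 'a" and A :: "'a set" and L :: "real \<Rightarrow> real"
    and P :: "'b measure" and U :: "'b \<Rightarrow> real"
  assumes "conservative_ergodic_system M T"
    and "emeasure M (space M) = \<infinity>"
    and "A \<in> sets M" and "0 < emeasure M A" and "emeasure M A < \<infinity>"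
    and "uniform_set M T A"
    and "regularly_varying_seq 1 (wandering_rate M T A)"
    and "slowly_varying L"
    and "wandering_rate M T A \<sim>[sequentially] (\<lambda>n. real n * (1 / L (real n)))"
    and "prob_space P" and "U \<in> borel_measurable P"
    and "distr P borel U = uniform_measure lborel {0..1}"
  shows "strong_distr_conv M (\<lambda>n x. L (real (last_visit M T A n x)) / L (real n)) P U"
proof -
  interpret conservative_ergodic_system M T by fact
  obtain f where unif: "uniform_set_for M T A f" using assms(6) by (auto simp: uniform_set_def)
  let ?W = "wandering_rate M T A" and ?w = "\<lambda>n. measure M (excursion_set M T A n)"
  note [measurable] = assms(3)
  obtain R where R: "regularly_varying 1 R" "\<And>n. n \<ge> 1 \<Longrightarrow> ?W n = R (real n)"
    using assms(7) by (auto simp: regularly_varying_seq_def)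
  have "((\<lambda>t. R (2 * t) / R t) \<longlongrightarrow> 2 powr 1) at_top"
    using R(1) by (simp add: regularly_varying_def)
  then have "(\<lambda>n. R (2 * real n) / R (real n)) \<longlonglongrightarrow> 2"
    using filterlim_compose[OF _ filterlim_real_sequentially] by fastforce
  then have W2: "(\<lambda>n. ?W (2 * n) / ?W n) \<longlonglongrightarrow> 2"
    by (rule Lim_transform_eventually)
       (use eventually_ge_at_top[of 1] in eventually_elim, simp add: R(2))
  interpret uniform_set_visits M T A f using unif W2 by unfold_locales
  have Wpos: "?W n \<noteq> 0" for n using W_pos[of n] by simp
  have "(\<lambda>n. ?W n / (real n * (1 / L (real n)))) \<longlonglongrightarrow> 1"
    \<comment> \<open>Asymptotic equivalence counts 0/0 as 1; since W n is nonzero, the plain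
      quotient converges.\<close>
    using assms(9) Wpos by (intro asymp_equivD_strong) (auto intro: always_eventually)
  then have "(\<lambda>n. ?W n * L (real n) / real n) \<longlonglongrightarrow> 1" by simp
  \<comment> \<open>In the product both n and W n cancel, which turns the assumption on L into L(n)
    w n -> 1.\<close>
  from tendsto_mult[OF this w_W_limit]
  have "(\<lambda>n. (?W n * L (real n) / real n) * (real n * ?w n / ?W n)) \<longlonglongrightarrow> 1" by simp
  then have Lw: "(\<lambda>n. L (real n) * ?w n) \<longlonglongrightarrow> 1"
    by (rule Lim_transform_eventually)
       (use eventually_gt_at_top[of 0] in eventually_elim, simp add: Wpos)
  show ?thesis
    unfolding strong_distr_conv_def weak_conv_m_def weak_conv_def
  proof (intro conjI allI ballI impI)
    show meas: "(\<lambda>x. L (real (last_visit M T A n x)) / L (real n)) \<in> borel_measurable M" for n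
      by measurable
    fix \<nu> x assume \<nu>: "\<nu> \<in> ac_prob M"
    then interpret \<nu>: prob_space \<nu> by (simp add: ac_prob_def)
    have s: "sets \<nu> = sets M" using \<nu> by (simp add: ac_prob_def)
    have sp: "space \<nu> = space M" by (rule sets_eq_imp_space_eq[OF s])
    let ?D = "\<lambda>n. distr \<nu> borel (\<lambda>x. L (real (last_visit M T A n x)) / L (real n))"
    have meas': "(\<lambda>x. L (real (last_visit M T A n x)) / L (real n)) \<in> borel_measurable \<nu>" for n
      using meas s by (simp cong: measurable_cong_sets)
    interpret D: real_distribution "?D n" for n
      using meas' by (intro \<nu>.real_distribution_distr)
    have cdf_eq: "cdf (?D n) u = measure \<nu> {x \<in> space M. L (real (last_visit M T A n x)) / L (real n) \<le> u}" for n u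
      unfolding cdf_def using meas'
      by (subst measure_distr) (auto simp: sp vimage_def Int_def conj_commute)
    have "(\<lambda>n. cdf (?D n) x) \<longlonglongrightarrow> min 1 (max 0 x)"
    proof (rule cdf_tendsto_uniform)
      show "mono (cdf (?D n))" for n by (intro monoI D.cdf_nondecreasing)
      show "0 \<le> cdf (?D n) y" for n y by (rule D.cdf_nonneg)
      show "cdf (?D n) y \<le> 1" for n y by (rule D.cdf_bounded_prob)
      show "(\<lambda>n. cdf (?D n) u) \<longlonglongrightarrow> u" if "0 < u" "u < 1" for u
        unfolding cdf_eq by (rule last_visit_law[OF Lw \<nu> that])
    qed
    then show "(\<lambda>n. cdf (?D n) x) \<longlonglongrightarrow> cdf (distr P borel U) x"
      unfolding assms(12) cdf_uniform_unit_interval .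
  qed
qed

end
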